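(* Let $\mathbb{F}$ be a field of characteristic zero, let $\mathfrak{k}$ be a finite dimensional perfect Lie superalgebra over $\mathbb{F}$ equipped with a nondegenerate homogeneous invariant supersymmetric bilinear form $\kappa$, and let $A$ be a unital supercommutative associative superalgebra over $\mathbb{F}$. Suppose that $\kappa$ is derivation invariant, that $D_1,\ldots,D_t\in\operatorname{der}(\mathfrak{k})$ are such that the cohomology classes $[\kappa_{D_j}]$ form a basis of $H^2(\mathfrak{k})$, and that $S_1,\ldots,S_m\in\mathfrak{cent}_+(\mathfrak{k})$ are such that the forms $\kappa_{S_i}$ form a basis of $\operatorname{Sym}(\mathfrak{k})^{\mathfrak{k}}$. Then each 2-cocycle of $\mathfrak{g}=A\otimes\mathfrak{k}$ with values in a superspace $M$ is cohomologous to a sum $\tilde\omega=\sum_{i=1}^t\eta_{f_i,D_i}+\sum_{j=1}^m\xi_{F_j,S_j}$, i.e., for homogeneous $a,b\in A$ and $x,y\in\mathfrak{k}$, $$\tilde\omega(a\otimes x,b\otimes y)=(-1)^{|b||x|}\sum_{i=1}^t f_i(ab)\,\kappa(D_ix,y)+(-1)^{|b||x|}\sum_{j=1}^m F_j(a,b)\,\kappa(S_jx,y),$$ where the $f_i\colon A\to M$ are linear maps and the $F_j\colon A\times A\to M$ are Hochschild maps.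
   Context: A superspace is a $\mathbb{Z}_2$-graded vector space; $|x|$ is the parity of a homogeneous element, and formulas involving parities are for homogeneous elements and extended linearly. A Lie superalgebra $\mathfrak{k}$ is perfect if $\mathfrak{k}=[\mathfrak{k},\mathfrak{k}]$. A bilinear map $\omega\colon\mathfrak{g}\times\mathfrak{g}\to M$ (with $\mathfrak{g}$ a Lie superalgebra, $M$ a superspace; $\omega$ need not be even) is a 2-cocycle if $\omega(x,y)=-(-1)^{|x||y|}\omega(y,x)$ and $\omega([x,y],z)=\omega(x,[y,z])-(-1)^{|x||y|}\omega(y,[x,z])$. It is a 2-coboundary if $\omega(x,y)=f([x,y])$ for some linear map $f\colon\mathfrak{g}\to M$. $Z^2(\mathfrak{g},M)$ and $B^2(\mathfrak{g},M)$ are the spaces of 2-cocycles and 2-coboundaries, $H^2(\mathfrak{g},M)=Z^2(\mathfrak{g},M)/B^2(\mathfrak{g},M)$, and $H^2(\mathfrak{k}):=H^2(\mathfrak{k},\mathbb{F})$. Two 2-cocycles are cohomologous if their difference is a 2-coboundary. A bilinear map $\alpha$ on $\mathfrak{k}$ is supersymmetric if $\alpha(x,y)=(-1)^{|x||y|}\alpha(y,x)$ and invariant if $\alpha([x,y],z)=\alpha(x,[y,z])$. $\operatorname{Sym}(\mathfrak{k})^{\mathfrak{k}}$ is the space of $\mathbb{F}$-valued supersymmetric invariant bilinear forms on $\mathfrak{k}$. "Homogeneous" for $\kappa$ means even or odd. $\operatorname{der}(\mathfrak{k})$ is the space of linear $D\colon\mathfrak{k}\to\mathfrak{k}$ with $D[x,y]=[Dx,y]-(-1)^{|x||y|}[Dy,x]$.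 The centroid is $\mathfrak{cent}_{\mathbb{F}}(\mathfrak{k})=\{\gamma\in\operatorname{End}(\mathfrak{k}):\gamma[a,b]=[\gamma(a),b]\ \forall a,b\}$. For $S\in\operatorname{End}(\mathfrak{k})$, $S^*\in\operatorname{End}(\mathfrak{k})$ is the unique endomorphism with $\kappa(Sx,y)=(-1)^{|x||y|}\kappa(S^*y,x)$. Put $\mathfrak{cent}_+(\mathfrak{k})=\{S\in\mathfrak{cent}_{\mathbb{F}}(\mathfrak{k}):S^*=S\}$ and $\operatorname{der}_-(\mathfrak{k})=\{D\in\operatorname{der}(\mathfrak{k}):D^*=-D\}$. The form $\kappa$ is derivation invariant if $\operatorname{der}(\mathfrak{k})=\operatorname{der}_-(\mathfrak{k})$. For $T\in\operatorname{End}(\mathfrak{k})$, $\kappa_T(x,y):=\kappa(Tx,y)$. The current superalgebra $\mathfrak{g}=A\otimes\mathfrak{k}$ has bracket $[a\otimes x,b\otimes y]=(-1)^{|x||b|}ab\otimes[x,y]$. A Hochschild map is a bilinear map $F\colon A\times A\to M$ with $F(a,b)=-(-1)^{|a||b|}F(b,a)$ and $F(ab,c)=F(a,bc)+(-1)^{|a||b|}F(b,ac)$. For a linear map $f\colon A\to M$, $D\in\operatorname{der}_-(\mathfrak{k})$, a Hochschild map $F$ and $S\in\mathfrak{cent}_+(\mathfrak{k})$ define the 2-cocycles of $\mathfrak{g}$: $\eta_{f,D}(a\otimes x,b\otimes y)=(-1)^{|b||x|}f(ab)\kappa(Dx,y)$ and $\xi_{F,S}(a\otimes x,b\otimes y)=(-1)^{|b||x|}F(a,b)\kappa(Sx,y)$.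 *)

theory Defs
  imports Complex_Main "HOL-Library.Z2" "HOL-Library.Poly_Mapping"
begin

section \<open>Superspaces and superalgebras\<close>

text \<open>
  Parities are elements of the field \<^typ>\<open>bit\<close> with two elements, and the sign
  $(-1)^{|x||y|}$ is \<open>psign (p * q)\<close> for \<open>x\<close> of parity \<open>p\<close> and \<open>y\<close> of parity \<open>q\<close>.
  Vector spaces occupy whole types and have an explicit scalar multiplication, as in
  the locale \<^locale>\<open>vector_space\<close>. A superspace additionally carries
  the family \<open>V\<close> of its homogeneous components.
\<close>

definition psign :: "bit \<Rightarrow> 'f::field" where
  "psign p = (if p = 0 then 1 else - 1)"

locale superspace = vector_space scale
  for scale :: "'f::field \<Rightarrow> 'v::ab_group_add \<Rightarrow> 'v" +
  fixes V :: "bit \<Rightarrow> 'v set"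
  assumes homogeneous_subspace: "subspace (V p)"
    and direct_sum: "\<exists>!(u, w). u \<in> V 0 \<and> w \<in> V 1 \<and> v = u + w"

definition bilin ::
  "('f::field \<Rightarrow> 'u::ab_group_add \<Rightarrow> 'u) \<Rightarrow> ('f \<Rightarrow> 'v::ab_group_add \<Rightarrow> 'v) \<Rightarrow>
   ('f \<Rightarrow> 'w::ab_group_add \<Rightarrow> 'w) \<Rightarrow> ('u \<Rightarrow> 'v \<Rightarrow> 'w) \<Rightarrow> bool" where
  "bilin sU sV sW \<beta> \<longleftrightarrow>
     (\<forall>v. Vector_Spaces.linear sU sW (\<lambda>u. \<beta> u v)) \<and> (\<forall>u. Vector_Spaces.linear sV sW (\<beta> u))"

text \<open>The sort \<open>{ring, monoid_mult}\<close>, unlike \<^class>\<open>ring_1\<close>, admits the zero algebra.\<close>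

locale supercommutative_superalgebra = superspace sA A
  for sA :: "'f::field \<Rightarrow> 'a::{ring, monoid_mult} \<Rightarrow> 'a" and A :: "bit \<Rightarrow> 'a set" +
  assumes mult_bilin: "bilin sA sA sA (*)"
    and mult_graded: "a \<in> A p \<Longrightarrow> b \<in> A q \<Longrightarrow> a * b \<in> A (p + q)"
    and supercommutative: "a \<in> A p \<Longrightarrow> b \<in> A q \<Longrightarrow> a * b = sA (psign (p * q)) (b * a)"

locale lie_superalgebra = superspace sK K
  for sK :: "'f::field \<Rightarrow> 'k::ab_group_add \<Rightarrow> 'k" and K :: "bit \<Rightarrow> 'k set" +
  fixes br :: "'k \<Rightarrow> 'k \<Rightarrow> 'k"
  assumes bracket_bilin: "bilin sK sK sK br"
    and bracket_graded: "x \<in> K p \<Longrightarrow> y \<in> K q \<Longrightarrow> br x y \<in> K (p + q)"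
    and bracket_skew: "x \<in> K p \<Longrightarrow> y \<in> K q \<Longrightarrow> br x y = - sK (psign (p * q)) (br y x)"
    and bracket_jacobi: "x \<in> K p \<Longrightarrow> y \<in> K q \<Longrightarrow>
      br x (br y z) = br (br x y) z + sK (psign (p * q)) (br y (br x z))"

definition finite_dimensional :: "('f::field \<Rightarrow> 'v::ab_group_add \<Rightarrow> 'v) \<Rightarrow> bool" where
  "finite_dimensional s \<longleftrightarrow> (\<exists>B. finite B \<and> module.span s B = UNIV)"

definition perfect ::
  "('f::field \<Rightarrow> 'k::ab_group_add \<Rightarrow> 'k) \<Rightarrow> ('k \<Rightarrow> 'k \<Rightarrow> 'k) \<Rightarrow> bool" where
  "perfect s br \<longleftrightarrow> module.span s {br x y | x y. True} = UNIV"


section \<open>Cohomology\<close>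

definition cocycles ::
  "('f::field \<Rightarrow> 'g::ab_group_add \<Rightarrow> 'g) \<Rightarrow> (bit \<Rightarrow> 'g set) \<Rightarrow> ('g \<Rightarrow> 'g \<Rightarrow> 'g) \<Rightarrow>
   ('f \<Rightarrow> 'm::ab_group_add \<Rightarrow> 'm) \<Rightarrow> ('g \<Rightarrow> 'g \<Rightarrow> 'm) set" where
  "cocycles sG G br sM = {\<omega>. bilin sG sG sM \<omega> \<and>
     (\<forall>p q. \<forall>x\<in>G p. \<forall>y\<in>G q. \<omega> x y = - sM (psign (p * q)) (\<omega> y x)) \<and>
     (\<forall>p q. \<forall>x\<in>G p. \<forall>y\<in>G q. \<forall>z.
        \<omega> (br x y) z = \<omega> x (br y z) - sM (psign (p * q)) (\<omega> y (br x z)))}"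

definition coboundaries ::
  "('f::field \<Rightarrow> 'g::ab_group_add \<Rightarrow> 'g) \<Rightarrow> ('g \<Rightarrow> 'g \<Rightarrow> 'g) \<Rightarrow>
   ('f \<Rightarrow> 'm::ab_group_add \<Rightarrow> 'm) \<Rightarrow> ('g \<Rightarrow> 'g \<Rightarrow> 'm) set" where
  "coboundaries sG br sM =
     {\<omega>. \<exists>f. Vector_Spaces.linear sG sM f \<and> \<omega> = (\<lambda>x y. f (br x y))}"

definition cohomologous ::
  "('f::field \<Rightarrow> 'g::ab_group_add \<Rightarrow> 'g) \<Rightarrow> (bit \<Rightarrow> 'g set) \<Rightarrow> ('g \<Rightarrow> 'g \<Rightarrow> 'g) \<Rightarrow>
   ('f \<Rightarrow> 'm::ab_group_add \<Rightarrow> 'm) \<Rightarrow> (('g \<Rightarrow> 'g \<Rightarrow> 'm) \<times> ('g \<Rightarrow> 'g \<Rightarrow> 'm)) set" where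
  "cohomologous sG G br sM = {(\<omega>, \<omega>').
     \<omega> \<in> cocycles sG G br sM \<and> \<omega>' \<in> cocycles sG G br sM \<and>
     (\<lambda>x y. \<omega> x y - \<omega>' x y) \<in> coboundaries sG br sM}"

definition H2 ::
  "('f::field \<Rightarrow> 'g::ab_group_add \<Rightarrow> 'g) \<Rightarrow> (bit \<Rightarrow> 'g set) \<Rightarrow> ('g \<Rightarrow> 'g \<Rightarrow> 'g) \<Rightarrow>
   ('f \<Rightarrow> 'm::ab_group_add \<Rightarrow> 'm) \<Rightarrow> ('g \<Rightarrow> 'g \<Rightarrow> 'm) set set" where
  "H2 sG G br sM = cocycles sG G br sM // cohomologous sG G br sM"

definition coh_class ::
  "('f::field \<Rightarrow> 'g::ab_group_add \<Rightarrow> 'g) \<Rightarrow> (bit \<Rightarrow> 'g set) \<Rightarrow> ('g \<Rightarrow> 'g \<Rightarrow> 'g) \<Rightarrow>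
   ('f \<Rightarrow> 'm::ab_group_add \<Rightarrow> 'm) \<Rightarrow> ('g \<Rightarrow> 'g \<Rightarrow> 'm) \<Rightarrow> ('g \<Rightarrow> 'g \<Rightarrow> 'm) set" where
  "coh_class sG G br sM \<omega> = cohomologous sG G br sM `` {\<omega>}"

definition form_lincomb ::
  "nat \<Rightarrow> (nat \<Rightarrow> 'f::field) \<Rightarrow> (nat \<Rightarrow> 'k \<Rightarrow> 'k \<Rightarrow> 'f) \<Rightarrow> 'k \<Rightarrow> 'k \<Rightarrow> 'f" where
  "form_lincomb n c \<alpha> = (\<lambda>x y. \<Sum>i = 1..n. c i * \<alpha> i x y)"

text \<open>
  In the following two definitions the basis is a family indexed by \<open>1, \<dots>, n\<close> (so in particular
  without repetitions): linearly independent and spanning.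
  In the quotient space $H^2$ the linear combination $\sum_i c_i [\alpha_i]$ is by definition
  the class $[\sum_i c_i \alpha_i]$, and the zero vector is the class of the zero form.
\<close>

definition forms_basis ::
  "nat \<Rightarrow> (nat \<Rightarrow> 'k \<Rightarrow> 'k \<Rightarrow> 'f::field) \<Rightarrow> ('k \<Rightarrow> 'k \<Rightarrow> 'f) set \<Rightarrow> bool" where
  "forms_basis n \<alpha> W \<longleftrightarrow>
     (\<forall>i\<in>{1..n}. \<alpha> i \<in> W) \<and>
     (\<forall>c. form_lincomb n c \<alpha> = (\<lambda>x y. 0) \<longrightarrow> (\<forall>i\<in>{1..n}. c i = 0)) \<and>
     (\<forall>\<beta>\<in>W. \<exists>c. \<beta> = form_lincomb n c \<alpha>)"

definition H2_basis ::
  "('f::field \<Rightarrow> 'k::ab_group_add \<Rightarrow> 'k) \<Rightarrow> (bit \<Rightarrow> 'k set) \<Rightarrow> ('k \<Rightarrow> 'k \<Rightarrow> 'k) \<Rightarrow>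
   nat \<Rightarrow> (nat \<Rightarrow> 'k \<Rightarrow> 'k \<Rightarrow> 'f) \<Rightarrow> bool" where
  "H2_basis sK K br n \<alpha> \<longleftrightarrow>
     (\<forall>i\<in>{1..n}. \<alpha> i \<in> cocycles sK K br (*)) \<and>
     (\<forall>c. coh_class sK K br (*) (form_lincomb n c \<alpha>) = coh_class sK K br (*) (\<lambda>x y. 0) \<longrightarrow>
        (\<forall>i\<in>{1..n}. c i = 0)) \<and>
     (\<forall>C\<in>H2 sK K br (*). \<exists>c. C = coh_class sK K br (*) (form_lincomb n c \<alpha>))"


section \<open>Invariant forms, derivations and the centroid\<close>

definition supersymmetric :: "(bit \<Rightarrow> 'k set) \<Rightarrow> ('k \<Rightarrow> 'k \<Rightarrow> 'f::field) \<Rightarrow> bool" where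
  "supersymmetric K \<alpha> \<longleftrightarrow> (\<forall>p q. \<forall>x\<in>K p. \<forall>y\<in>K q. \<alpha> x y = psign (p * q) * \<alpha> y x)"

definition invariant_form :: "('k \<Rightarrow> 'k \<Rightarrow> 'k) \<Rightarrow> ('k \<Rightarrow> 'k \<Rightarrow> 'f) \<Rightarrow> bool" where
  "invariant_form br \<alpha> \<longleftrightarrow> (\<forall>x y z. \<alpha> (br x y) z = \<alpha> x (br y z))"

text \<open>\<open>d\<close> is the parity of the form: even for \<open>d = 0\<close>, odd for \<open>d = 1\<close>.\<close>

definition homogeneous_form :: "(bit \<Rightarrow> 'k set) \<Rightarrow> ('k \<Rightarrow> 'k \<Rightarrow> 'f::zero) \<Rightarrow> bool" where
  "homogeneous_form K \<alpha> \<longleftrightarrow>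
     (\<exists>d. \<forall>p q. \<forall>x\<in>K p. \<forall>y\<in>K q. p + q \<noteq> d \<longrightarrow> \<alpha> x y = 0)"

definition nondegenerate :: "('k::zero \<Rightarrow> 'k \<Rightarrow> 'f::zero) \<Rightarrow> bool" where
  "nondegenerate \<alpha> \<longleftrightarrow>
     (\<forall>x. (\<forall>y. \<alpha> x y = 0) \<longrightarrow> x = 0) \<and> (\<forall>y. (\<forall>x. \<alpha> x y = 0) \<longrightarrow> y = 0)"

definition invariant_forms ::
  "('f::field \<Rightarrow> 'k::ab_group_add \<Rightarrow> 'k) \<Rightarrow> (bit \<Rightarrow> 'k set) \<Rightarrow> ('k \<Rightarrow> 'k \<Rightarrow> 'k) \<Rightarrow>
   ('k \<Rightarrow> 'k \<Rightarrow> 'f) set" where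
  "invariant_forms sK K br = {\<alpha>. bilin sK sK (*) \<alpha> \<and> supersymmetric K \<alpha> \<and> invariant_form br \<alpha>}"

definition der ::
  "('f::field \<Rightarrow> 'k::ab_group_add \<Rightarrow> 'k) \<Rightarrow> (bit \<Rightarrow> 'k set) \<Rightarrow> ('k \<Rightarrow> 'k \<Rightarrow> 'k) \<Rightarrow>
   ('k \<Rightarrow> 'k) set" where
  "der sK K br = {D. Vector_Spaces.linear sK sK D \<and>
     (\<forall>p q. \<forall>x\<in>K p. \<forall>y\<in>K q.
        D (br x y) = br (D x) y - sK (psign (p * q)) (br (D y) x))}"

definition centroid ::
  "('f::field \<Rightarrow> 'k::ab_group_add \<Rightarrow> 'k) \<Rightarrow> ('k \<Rightarrow> 'k \<Rightarrow> 'k) \<Rightarrow> ('k \<Rightarrow> 'k) set" where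
  "centroid sK br = {\<gamma>. Vector_Spaces.linear sK sK \<gamma> \<and> (\<forall>x y. \<gamma> (br x y) = br (\<gamma> x) y)}"

text \<open>
  The adjoint exists and is unique if \<open>\<kappa>\<close> is nondegenerate and the space finite dimensional.
\<close>

definition super_adjoint ::
  "('f::field \<Rightarrow> 'k::ab_group_add \<Rightarrow> 'k) \<Rightarrow> (bit \<Rightarrow> 'k set) \<Rightarrow> ('k \<Rightarrow> 'k \<Rightarrow> 'f) \<Rightarrow>
   ('k \<Rightarrow> 'k) \<Rightarrow> 'k \<Rightarrow> 'k" where
  "super_adjoint sK K \<kappa> S = (THE T. Vector_Spaces.linear sK sK T \<and>
     (\<forall>p q. \<forall>x\<in>K p. \<forall>y\<in>K q. \<kappa> (S x) y = psign (p * q) * \<kappa> (T y) x))"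

definition cent_plus ::
  "('f::field \<Rightarrow> 'k::ab_group_add \<Rightarrow> 'k) \<Rightarrow> (bit \<Rightarrow> 'k set) \<Rightarrow> ('k \<Rightarrow> 'k \<Rightarrow> 'k) \<Rightarrow>
   ('k \<Rightarrow> 'k \<Rightarrow> 'f) \<Rightarrow> ('k \<Rightarrow> 'k) set" where
  "cent_plus sK K br \<kappa> = {S \<in> centroid sK br. super_adjoint sK K \<kappa> S = S}"

definition der_minus ::
  "('f::field \<Rightarrow> 'k::ab_group_add \<Rightarrow> 'k) \<Rightarrow> (bit \<Rightarrow> 'k set) \<Rightarrow> ('k \<Rightarrow> 'k \<Rightarrow> 'k) \<Rightarrow>
   ('k \<Rightarrow> 'k \<Rightarrow> 'f) \<Rightarrow> ('k \<Rightarrow> 'k) set" where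
  "der_minus sK K br \<kappa> = {D \<in> der sK K br. super_adjoint sK K \<kappa> D = (\<lambda>x. - D x)}"

definition derivation_invariant ::
  "('f::field \<Rightarrow> 'k::ab_group_add \<Rightarrow> 'k) \<Rightarrow> (bit \<Rightarrow> 'k set) \<Rightarrow> ('k \<Rightarrow> 'k \<Rightarrow> 'k) \<Rightarrow>
   ('k \<Rightarrow> 'k \<Rightarrow> 'f) \<Rightarrow> bool" where
  "derivation_invariant sK K br \<kappa> \<longleftrightarrow> der sK K br = der_minus sK K br \<kappa>"

definition twist_form :: "('k \<Rightarrow> 'k \<Rightarrow> 'f) \<Rightarrow> ('k \<Rightarrow> 'k) \<Rightarrow> 'k \<Rightarrow> 'k \<Rightarrow> 'f" where
  "twist_form \<kappa> T = (\<lambda>x y. \<kappa> (T x) y)"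


section \<open>Tensor products and current superalgebras\<close>

text \<open>
  The tensor product is the free vector space on $A \times K$ modulo the span of the bilinearity
  relations. Since a type cannot depend on the scalar multiplications of \<open>A\<close> and \<open>K\<close>, the
  vector space \<open>T\<close> with the map \<open>tens\<close> (to be read as $(a, x) \mapsto a \otimes x$) is said to
  be a tensor product if the linear map \<open>free_lift sT tens\<close>
  from the free vector space to \<open>T\<close> that sends the generator $(a, x)$ to \<open>tens a x\<close> is
  surjective with the span of the bilinearity relations as its kernel.
\<close>

definition free_scale :: "'f::field \<Rightarrow> ('b \<Rightarrow>\<^sub>0 'f) \<Rightarrow> ('b \<Rightarrow>\<^sub>0 'f)" where
  "free_scale c u = Poly_Mapping.map (\<lambda>d. c * d) u"

definition bilinearity_relations ::
  "('f::field \<Rightarrow> 'a::ab_group_add \<Rightarrow> 'a) \<Rightarrow> ('f \<Rightarrow> 'k::ab_group_add \<Rightarrow> 'k) \<Rightarrow>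
   ('a \<times> 'k \<Rightarrow>\<^sub>0 'f) set" where
  "bilinearity_relations sA sK =
     {Poly_Mapping.single (a + b, x) 1 - Poly_Mapping.single (a, x) 1
        - Poly_Mapping.single (b, x) 1 | a b x. True} \<union>
     {Poly_Mapping.single (a, x + y) 1 - Poly_Mapping.single (a, x) 1
        - Poly_Mapping.single (a, y) 1 | a x y. True} \<union>
     {Poly_Mapping.single (sA c a, x) 1 - free_scale c (Poly_Mapping.single (a, x) 1)
        | c a x. True} \<union>
     {Poly_Mapping.single (a, sK c x) 1 - free_scale c (Poly_Mapping.single (a, x) 1)
        | c a x. True}"

definition free_lift ::
  "('f::field \<Rightarrow> 't::ab_group_add \<Rightarrow> 't) \<Rightarrow> ('a \<Rightarrow> 'k \<Rightarrow> 't) \<Rightarrow> ('a \<times> 'k \<Rightarrow>\<^sub>0 'f) \<Rightarrow> 't" where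
  "free_lift sT tens u =
     (\<Sum>(a, x)\<in>Poly_Mapping.keys u. sT (Poly_Mapping.lookup u (a, x)) (tens a x))"

definition tensor_product ::
  "('f::field \<Rightarrow> 'a::ab_group_add \<Rightarrow> 'a) \<Rightarrow> ('f \<Rightarrow> 'k::ab_group_add \<Rightarrow> 'k) \<Rightarrow>
   ('f \<Rightarrow> 't::ab_group_add \<Rightarrow> 't) \<Rightarrow> ('a \<Rightarrow> 'k \<Rightarrow> 't) \<Rightarrow> bool" where
  "tensor_product sA sK sT tens \<longleftrightarrow>
     vector_space sT \<and> surj (free_lift sT tens) \<and>
     {u. free_lift sT tens u = 0} = module.span free_scale (bilinearity_relations sA sK)"

definition tensor_grading ::
  "('f::field \<Rightarrow> 't::ab_group_add \<Rightarrow> 't) \<Rightarrow> ('a \<Rightarrow> 'k \<Rightarrow> 't) \<Rightarrow>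
   (bit \<Rightarrow> 'a set) \<Rightarrow> (bit \<Rightarrow> 'k set) \<Rightarrow> bit \<Rightarrow> 't set" where
  "tensor_grading sT tens A K p =
     module.span sT {tens a x | a x. \<exists>q r. q + r = p \<and> a \<in> A q \<and> x \<in> K r}"

definition current_bracket ::
  "(bit \<Rightarrow> 'a::times set) \<Rightarrow> (bit \<Rightarrow> 'k set) \<Rightarrow> ('k \<Rightarrow> 'k \<Rightarrow> 'k) \<Rightarrow>
   ('f::field \<Rightarrow> 'g::ab_group_add \<Rightarrow> 'g) \<Rightarrow> ('a \<Rightarrow> 'k \<Rightarrow> 'g) \<Rightarrow> ('g \<Rightarrow> 'g \<Rightarrow> 'g) \<Rightarrow> bool" where
  "current_bracket A K br sG tens brG \<longleftrightarrow> bilin sG sG sG brG \<and>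
     (\<forall>p q. \<forall>x\<in>K p. \<forall>b\<in>A q. \<forall>a y.
        brG (tens a x) (tens b y) = sG (psign (p * q)) (tens (a * b) (br x y)))"

definition hochschild_map ::
  "('f::field \<Rightarrow> 'a::{ab_group_add, times} \<Rightarrow> 'a) \<Rightarrow> (bit \<Rightarrow> 'a set) \<Rightarrow>
   ('f \<Rightarrow> 'm::ab_group_add \<Rightarrow> 'm) \<Rightarrow> ('a \<Rightarrow> 'a \<Rightarrow> 'm) \<Rightarrow> bool" where
  "hochschild_map sA A sM F \<longleftrightarrow> bilin sA sA sM F \<and>
     (\<forall>p q. \<forall>a\<in>A p. \<forall>b\<in>A q. F a b = - sM (psign (p * q)) (F b a)) \<and>
     (\<forall>p q. \<forall>a\<in>A p. \<forall>b\<in>A q. \<forall>c.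
        F (a * b) c = F a (b * c) + sM (psign (p * q)) (F b (a * c)))"

text \<open>
  The bilinear map on $A \otimes K$ given by
  $(a \otimes x, b \otimes y) \mapsto (-1)^{|b||x|} \Phi(a, b) \kappa(T x, y)$; it is
  determined by this rule, because the \<open>tens a x\<close> with \<open>x\<close> homogeneous span the tensor product,
  and so do the \<open>tens b y\<close> with \<open>b\<close> homogeneous.
\<close>

definition current_form ::
  "(bit \<Rightarrow> 'a set) \<Rightarrow> (bit \<Rightarrow> 'k set) \<Rightarrow> ('k \<Rightarrow> 'k \<Rightarrow> 'f::field) \<Rightarrow>
   ('f \<Rightarrow> 'g::ab_group_add \<Rightarrow> 'g) \<Rightarrow> ('a \<Rightarrow> 'k \<Rightarrow> 'g) \<Rightarrow> ('f \<Rightarrow> 'm::ab_group_add \<Rightarrow> 'm) \<Rightarrow>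
   ('a \<Rightarrow> 'a \<Rightarrow> 'm) \<Rightarrow> ('k \<Rightarrow> 'k) \<Rightarrow> 'g \<Rightarrow> 'g \<Rightarrow> 'm" where
  "current_form A K \<kappa> sG tens sM \<Phi> T = (THE h. bilin sG sG sM h \<and>
     (\<forall>p q. \<forall>x\<in>K p. \<forall>b\<in>A q. \<forall>a y.
        h (tens a x) (tens b y) = sM (psign (q * p) * \<kappa> (T x) y) (\<Phi> a b)))"

definition eta ::
  "(bit \<Rightarrow> 'a::times set) \<Rightarrow> (bit \<Rightarrow> 'k set) \<Rightarrow> ('k \<Rightarrow> 'k \<Rightarrow> 'f::field) \<Rightarrow>
   ('f \<Rightarrow> 'g::ab_group_add \<Rightarrow> 'g) \<Rightarrow> ('a \<Rightarrow> 'k \<Rightarrow> 'g) \<Rightarrow> ('f \<Rightarrow> 'm::ab_group_add \<Rightarrow> 'm) \<Rightarrow>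
   ('a \<Rightarrow> 'm) \<Rightarrow> ('k \<Rightarrow> 'k) \<Rightarrow> 'g \<Rightarrow> 'g \<Rightarrow> 'm" where
  "eta A K \<kappa> sG tens sM f D = current_form A K \<kappa> sG tens sM (\<lambda>a b. f (a * b)) D"

definition xi ::
  "(bit \<Rightarrow> 'a set) \<Rightarrow> (bit \<Rightarrow> 'k set) \<Rightarrow> ('k \<Rightarrow> 'k \<Rightarrow> 'f::field) \<Rightarrow>
   ('f \<Rightarrow> 'g::ab_group_add \<Rightarrow> 'g) \<Rightarrow> ('a \<Rightarrow> 'k \<Rightarrow> 'g) \<Rightarrow> ('f \<Rightarrow> 'm::ab_group_add \<Rightarrow> 'm) \<Rightarrow>
   ('a \<Rightarrow> 'a \<Rightarrow> 'm) \<Rightarrow> ('k \<Rightarrow> 'k) \<Rightarrow> 'g \<Rightarrow> 'g \<Rightarrow> 'm" where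
  "xi A K \<kappa> sG tens sM F S = current_form A K \<kappa> sG tens sM F S"

end

theory Submission
  imports Defs
begin

text \<open>
  Every bilinear map on \<open>A \<otimes> K\<close> can be written as
  \<open>(a \<otimes> x, b \<otimes> y) \<mapsto> (-1)\<^bsup>|b||x|\<^esup> Q(a, b, x, y)\<close>. Once this sign is taken out, the
  two cocycle conditions read
    \<open>Q(a, b, x, y) = -(-1)\<^bsup>|a||b|+|x||y|\<^esup> Q(b, a, y, x)\<close> and
    \<open>Q(ab, c, [x,y], z) = Q(a, bc, x, [y,z]) - (-1)\<^bsup>|a||b|+|x||y|\<^esup> Q(b, ac, y, [x,z])\<close>,
  so the factors \<open>A\<close> and \<open>K\<close> contribute independent signs and the parities of \<open>c\<close> and \<open>z\<close> do
  not occur (\<open>represents_cocycle_iff\<close>). The theorem now follows by inserting the unit of \<open>A\<close>.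

  For \<open>a = b = 1\<close> the second condition says that \<open>Q(1, c, x, y) = \<kappa>(Dx, y)\<close> with a (vector
  valued) derivation \<open>D\<close> of \<open>K\<close>. Derivation invariance of \<open>\<kappa>\<close> is exactly what makes this form
  skew (\<open>derivation_form_cocycle\<close>), so \<open>Q(1, c, -, -)\<close> is a 2-cocycle of \<open>K\<close> and equals
  \<open>\<Sum>\<^sub>i \<kappa>(D\<^sub>i x, y) f\<^sub>i(c) + g\<^sub>c([x,y])\<close>.

  Because \<open>A\<close> is associative and supercommutative, \<open>Q(1, ab, x, y)\<close> satisfies both conditions
  again. The difference \<open>R(a, b, x, y) = Q(a, b, x, y) - Q(1, ab, x, y)\<close> therefore satisfies
  them too, and it vanishes for \<open>a = 1\<close>; the second condition with \<open>a = 1\<close> then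
  degenerates to the invariance of all forms \<open>R(b, c, -, -)\<close> (\<open>current_cocycle_invariant\<close>).
  On a perfect algebra invariant forms are supersymmetric (\<open>invariant_imp_symmetric\<close>), hence
  \<open>R(a, b, x, y) = \<Sum>\<^sub>j \<kappa>(S\<^sub>j x, y) F\<^sub>j(a, b)\<close>, and comparing coefficients in the two conditions
  shows that the \<open>F\<^sub>j\<close> are Hochschild maps. What remains of \<open>Q\<close> is \<open>g\<^sub>a\<^sub>b([x,y])\<close>, a coboundary.

  The hypotheses speak of scalar forms on \<open>K\<close>, whereas the forms above have values in a space
  \<open>M\<close> of any dimension. As \<open>K\<close> is finite dimensional, finitely many coordinate functionals of
  \<open>M\<close> suffice to describe such a form, which gives the expansions
  (\<open>vector_valued_expansion\<close>). They exist for each \<open>c\<close>, or each pair \<open>(a, b)\<close>, separately; the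
  coefficients depend linearly on these parameters because they are unique.
\<close>

section \<open>Signs, linear and bilinear maps\<close>

text \<open>
  Parities are multiplied and added as elements of a field; rewriting them to bit operations
  would hide the ring structure that the sign rules use.
\<close>
declare add_bit_eq_xor [simp del] mult_bit_eq_and [simp del]

lemma psign_simps [simp]: "psign 0 = 1" "psign 1 = - 1"
  by (simp_all add: psign_def)

lemma bit_one_plus_one [simp]: "(1::bit) + 1 = 0"
  by (simp add: add_bit_eq_xor)

lemma psign_add: "psign (p + q) = psign p * psign q"
  by (cases p; cases q) simp_all

lemma psign_square [simp]: "psign p * psign p = 1" "psign p * (psign p * c) = c"
  by (cases p; simp)+

lemma psign_nonzero [simp]: "psign p \<noteq> 0"
  by (cases p) simp_all

lemma linear_eqs:
  assumes "Vector_Spaces.linear s1 s2 f"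
  shows "f (x + y) = f x + f y" "f (s1 c x) = s2 c (f x)" "f 0 = 0" "f (- x) = - f x"
    "f (x - y) = f x - f y" "f (sum g I) = (\<Sum>i\<in>I. f (g i))"
proof -
  interpret Vector_Spaces.linear s1 s2 f by fact
  show "f (x + y) = f x + f y" "f (s1 c x) = s2 c (f x)" "f 0 = 0" "f (- x) = - f x"
    "f (x - y) = f x - f y" "f (sum g I) = (\<Sum>i\<in>I. f (g i))"
    by (simp_all add: add scale diff neg sum)
qed

lemma linear_vector_spaces:
  assumes "Vector_Spaces.linear s1 s2 f"
  shows "vector_space s1" "vector_space s2"
  using assms by (simp_all add: Vector_Spaces.linear_iff)

lemma linearI:
  assumes "vector_space s1" "vector_space s2"
    and "\<And>x y. f (x + y) = f x + f y" and "\<And>c x. f (s1 c x) = s2 c (f x)"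
  shows "Vector_Spaces.linear s1 s2 f"
  using assms by (simp add: Vector_Spaces.linear_iff)

lemma vector_space_mult: "vector_space ((*) :: 'f::field \<Rightarrow> 'f \<Rightarrow> 'f)"
  by unfold_locales (simp_all add: algebra_simps)

lemma linear_comp:
  assumes "Vector_Spaces.linear s1 s2 f" "Vector_Spaces.linear s2 s3 g"
  shows "Vector_Spaces.linear s1 s3 (\<lambda>x. g (f x))"
  using Vector_Spaces.linear_compose[OF assms] by (simp add: o_def)

lemma bilinI:
  assumes "vector_space sU" "vector_space sV" "vector_space sW"
    and "\<And>u u' v. \<beta> (u + u') v = \<beta> u v + \<beta> u' v" and "\<And>c u v. \<beta> (sU c u) v = sW c (\<beta> u v)"
    and "\<And>u v v'. \<beta> u (v + v') = \<beta> u v + \<beta> u v'" and "\<And>c u v. \<beta> u (sV c v) = sW c (\<beta> u v)"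
  shows "bilin sU sV sW \<beta>"
  using assms by (simp add: bilin_def linearI)

lemma bilin_vector_spaces:
  assumes "bilin sU sV sW \<beta>"
  shows "vector_space sU" "vector_space sV" "vector_space sW"
  using assms linear_vector_spaces unfolding bilin_def by metis+

lemma bilin_linear:
  assumes "bilin sU sV sW \<beta>"
  shows "Vector_Spaces.linear sU sW (\<lambda>u. \<beta> u v)" "Vector_Spaces.linear sV sW (\<beta> u)"
  using assms by (simp_all add: bilin_def)

lemma bilin_eqs:
  assumes "bilin sU sV sW \<beta>"
  shows "\<beta> (u + u') v = \<beta> u v + \<beta> u' v" "\<beta> u (v + v') = \<beta> u v + \<beta> u v'"
    "\<beta> (sU c u) v = sW c (\<beta> u v)" "\<beta> u (sV c v) = sW c (\<beta> u v)"
    "\<beta> 0 v = 0" "\<beta> u 0 = 0" "\<beta> (- u) v = - \<beta> u v" "\<beta> u (- v) = - \<beta> u v"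
    "\<beta> (u - u') v = \<beta> u v - \<beta> u' v" "\<beta> u (v - v') = \<beta> u v - \<beta> u v'"
    "\<beta> (sum g I) v = (\<Sum>i\<in>I. \<beta> (g i) v)" "\<beta> u (sum h I) = (\<Sum>i\<in>I. \<beta> u (h i))"
  using linear_eqs[OF bilin_linear(1)[OF assms, of v]] linear_eqs[OF bilin_linear(2)[OF assms, of u]]
  by simp_all

lemma bilin_linear_comp:
  assumes "bilin sU sV sW \<beta>" "Vector_Spaces.linear sW s g"
  shows "bilin sU sV s (\<lambda>u v. g (\<beta> u v))"
  using linear_comp[OF bilin_linear(1)[OF assms(1)] assms(2)]
    linear_comp[OF bilin_linear(2)[OF assms(1)] assms(2)]
  by (simp add: bilin_def)

lemma bilin_diff:
  assumes "bilin sU sV sW \<beta>" "bilin sU sV sW \<beta>'"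
  shows "bilin sU sV sW (\<lambda>u v. \<beta> u v - \<beta>' u v)"
proof -
  interpret vector_space sW by (rule bilin_vector_spaces[OF assms(1)])
  show ?thesis
    by (rule bilinI)
      (simp_all add: bilin_vector_spaces[OF assms(1)] bilin_eqs[OF assms(1)] bilin_eqs[OF assms(2)]
        scale_right_diff_distrib)
qed

lemma bilin_sum:
  assumes "vector_space sU" "vector_space sV" "vector_space sW"
    and "\<And>i. i \<in> I \<Longrightarrow> bilin sU sV sW (\<beta> i)"
  shows "bilin sU sV sW (\<lambda>u v. \<Sum>i\<in>I. \<beta> i u v)"
proof -
  interpret vector_space sW by fact
  have eqs: "(\<Sum>i\<in>I. \<beta> i (u + u') v) = (\<Sum>i\<in>I. \<beta> i u v + \<beta> i u' v)"
    "(\<Sum>i\<in>I. \<beta> i (sU c u) v) = (\<Sum>i\<in>I. sW c (\<beta> i u v))"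
    "(\<Sum>i\<in>I. \<beta> i u (v + v')) = (\<Sum>i\<in>I. \<beta> i u v + \<beta> i u v')"
    "(\<Sum>i\<in>I. \<beta> i u (sV c v)) = (\<Sum>i\<in>I. sW c (\<beta> i u v))" for u u' v v' c
    by (rule sum.cong[OF refl]; rule bilin_eqs[OF assms(4)]; assumption)+
  show ?thesis
    by (rule bilinI) (simp_all add: assms(1-3) eqs sum.distrib scale_sum_right)
qed

section \<open>Homogeneous components\<close>

context superspace
begin

definition component :: "bit \<Rightarrow> 'v \<Rightarrow> 'v" where
  "component p v = (THE u. u \<in> V p \<and> v - u \<in> V (p + 1))"

lemma homogeneous_zero: "0 \<in> V p"
  and homogeneous_add: "u \<in> V p \<Longrightarrow> w \<in> V p \<Longrightarrow> u + w \<in> V p"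
  and homogeneous_diff: "u \<in> V p \<Longrightarrow> w \<in> V p \<Longrightarrow> u - w \<in> V p"
  and homogeneous_scale: "u \<in> V p \<Longrightarrow> scale c u \<in> V p"
  using homogeneous_subspace[of p]
  by (simp_all add: subspace_0 subspace_add subspace_diff subspace_scale)

lemma homogeneous_disjoint:
  assumes "u \<in> V p" "u \<in> V (p + 1)"
  shows "u = 0"
proof -
  have uu: "u \<in> V 0" "u \<in> V 1" using assms by (cases p; simp)+
  obtain z where z: "\<And>y. (case y of (a, w) \<Rightarrow> a \<in> V 0 \<and> w \<in> V 1 \<and> u = a + w) \<Longrightarrow> y = z"
    using direct_sum[of u] by blast
  have "(u, 0) = z" "(0, u) = z"
    by (rule z; use uu homogeneous_zero in simp)+
  then show ?thesis by auto
qed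

lemma component_unique:
  assumes "u \<in> V p" "v - u \<in> V (p + 1)"
  shows "component p v = u"
  unfolding component_def
proof (rule the_equality)
  show "u \<in> V p \<and> v - u \<in> V (p + 1)" using assms by simp
  fix w assume w: "w \<in> V p \<and> v - w \<in> V (p + 1)"
  then have "w - u \<in> V p" "(v - u) - (v - w) \<in> V (p + 1)"
    using assms homogeneous_diff by blast+
  then have "w - u = 0" by (intro homogeneous_disjoint) simp_all
  then show "w = u" by simp
qed

lemma component_props: "component p v \<in> V p \<and> v - component p v \<in> V (p + 1)"
proof -
  obtain u w where uw: "u \<in> V 0" "w \<in> V 1" "v = u + w" using direct_sum[of v] by auto
  have "\<exists>x. x \<in> V p \<and> v - x \<in> V (p + 1)"
  proof (cases "p = 0")
    case True
    with uw show ?thesis by (intro exI[of _ u]) simp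
  next
    case False
    with uw show ?thesis by (intro exI[of _ w]) simp
  qed
  then show ?thesis using component_unique by metis
qed

lemma component_mem [simp]: "component p v \<in> V p"
  using component_props by blast

lemma component_same: "v \<in> V p \<Longrightarrow> component p v = v"
  by (rule component_unique) (simp_all add: homogeneous_zero)

lemma component_other: "v \<in> V p \<Longrightarrow> component (p + 1) v = 0"
  by (rule component_unique) (simp_all add: homogeneous_zero add.assoc)

lemma component_decomp: "component 0 v + component 1 v = v"
proof -
  have "component 1 v = v - component 0 v"
    by (rule component_unique) (use component_props[of 0 v] in simp_all)
  then show ?thesis by simp
qed

lemma component_add: "component p (u + v) = component p u + component p v"
proof (rule component_unique)
  have "u + v - (component p u + component p v) = (u - component p u) + (v - component p v)"
    by simp
  then show "u + v - (component p u + component p v) \<in> V (p + 1)"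
    using component_props homogeneous_add by metis
qed (simp add: homogeneous_add)

lemma component_scale: "component p (scale c v) = scale c (component p v)"
proof (rule component_unique)
  show "scale c v - scale c (component p v) \<in> V (p + 1)"
    unfolding scale_right_diff_distrib[symmetric] using component_props homogeneous_scale by blast
qed (simp add: homogeneous_scale)

lemma homogeneous_induct [case_names add homogeneous]:
  assumes "\<And>u w. P u \<Longrightarrow> P w \<Longrightarrow> P (u + w)" and "\<And>p u. u \<in> V p \<Longrightarrow> P u"
  shows "P v"
  using assms(1)[OF assms(2) assms(2)] component_decomp[of v] component_mem by metis

definition parity_involution :: "'v \<Rightarrow> 'v" where
  "parity_involution v = component 0 v - component 1 v"

lemma parity_involution_homogeneous:
  assumes "v \<in> V p" shows "parity_involution v = scale (psign p) v"
  using component_same[OF assms] component_other[OF assms]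
  by (cases p) (simp_all add: parity_involution_def)

lemma parity_involution_add: "parity_involution (u + v) = parity_involution u + parity_involution v"
  and parity_involution_scale: "parity_involution (scale c v) = scale c (parity_involution v)"
  by (simp_all add: parity_involution_def component_add component_scale scale_right_diff_distrib)

end

section \<open>Nondegenerate forms on finite dimensional spaces\<close>

lemma finite_dimensional_basis:
  assumes "vector_space s" "finite_dimensional s"
  obtains B where "finite_dimensional_vector_space s B"
proof -
  interpret vector_space s by fact
  obtain S where S: "finite S" "span S = UNIV" using assms(2) unfolding finite_dimensional_def by blast
  obtain B where B: "B \<subseteq> S" "independent B" "S \<subseteq> span B"
    using maximal_independent_subset by blast
  have "span B = UNIV" using B(3) S(2) span_mono[OF B(3)] span_span by auto
  then have "finite_dimensional_vector_space s B"
    using B S(1) by unfold_locales (auto intro: finite_subset)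
  then show thesis by (rule that)
qed

text \<open>
  In the coordinates of a basis, \<open>x \<mapsto> \<kappa> x\<close> becomes an injective endomorphism of \<open>K\<close>, which is
  surjective for dimension reasons. This avoids the dual space.
\<close>
lemma nondegenerate_functional:
  assumes fin: "finite_dimensional sK" and \<kappa>: "bilin sK sK (*) \<kappa>" and nd: "nondegenerate \<kappa>"
    and \<phi>: "Vector_Spaces.linear sK (*) \<phi>"
  shows "\<exists>x. \<forall>y. \<kappa> x y = \<phi> y"
proof -
  note vs = bilin_vector_spaces(1)[OF \<kappa>]
  obtain B where "finite_dimensional_vector_space sK B" using finite_dimensional_basis[OF vs fin] .
  then interpret finite_dimensional_vector_space sK B .
  define L where "L x = (\<Sum>e\<in>B. sK (\<kappa> x e) e)" for x
  have coeff: "c e = 0" if "(\<Sum>e\<in>B. sK (c e) e) = 0" "e \<in> B" for c :: "'b \<Rightarrow> 'a" and e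
    using independentD[OF independent_Basis finite_Basis order_refl that] .
  have linL: "Vector_Spaces.linear sK sK L"
    by (rule linearI[OF vs vs])
      (simp_all add: L_def bilin_eqs[OF \<kappa>] scale_left_distrib sum.distrib scale_sum_right)
  have ext: "\<forall>y. h y = 0" if h: "Vector_Spaces.linear sK (*) h" "\<And>e. e \<in> B \<Longrightarrow> h e = 0" for h
  proof
    fix y
    have "y \<in> span B" by (simp add: span_Basis)
    then show "h y = 0"
      by (induction rule: span_induct_alt) (simp_all add: linear_eqs[OF h(1)] h(2))
  qed
  have "inj L"
  proof (rule injI)
    fix x x' assume "L x = L x'"
    then have "(\<Sum>e\<in>B. sK (\<kappa> (x - x') e) e) = 0"
      using linear_eqs(5)[OF linL, of x x'] by (simp add: L_def)
    then have "\<kappa> (x - x') e = 0" if "e \<in> B" for e using coeff that by blast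
    then have "\<forall>y. \<kappa> (x - x') y = 0" using ext[OF bilin_linear(2)[OF \<kappa>]] by blast
    then show "x = x'" using nd unfolding nondegenerate_def by force
  qed
  then have "surj L" by (rule linear_inj_imp_surj[OF linL])
  then obtain x where x: "L x = (\<Sum>e\<in>B. sK (\<phi> e) e)" by (metis surjD)
  have "(\<Sum>e\<in>B. sK (\<kappa> x e - \<phi> e) e) = 0"
    using x by (simp add: L_def scale_left_diff_distrib sum_subtractf)
  then have "\<kappa> x e - \<phi> e = 0" if "e \<in> B" for e
    using coeff[of "\<lambda>e. \<kappa> x e - \<phi> e"] that by blast
  moreover have "Vector_Spaces.linear sK (*) (\<lambda>y. \<kappa> x y - \<phi> y)"
    by (rule linearI[OF vs vector_space_mult])
      (simp_all add: bilin_eqs[OF \<kappa>] linear_eqs[OF \<phi>] algebra_simps)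
  ultimately have "\<forall>y. \<kappa> x y - \<phi> y = 0" using ext by blast
  then show ?thesis by auto
qed

lemma nondegenerate_eqI:
  assumes \<kappa>: "bilin sK sK (*) \<kappa>" and nd: "nondegenerate \<kappa>" and "\<And>y. \<kappa> u y = \<kappa> v y"
  shows "u = v"
proof -
  have "\<kappa> (u - v) y = 0" for y using assms by (simp add: bilin_eqs[OF \<kappa>])
  then show ?thesis using nd unfolding nondegenerate_def by force
qed

lemma nondegenerate_form:
  assumes fin: "finite_dimensional sK" and \<kappa>: "bilin sK sK (*) \<kappa>" and nd: "nondegenerate \<kappa>"
    and \<beta>: "bilin sK sK (*) \<beta>"
  shows "\<exists>T. Vector_Spaces.linear sK sK T \<and> (\<forall>x y. \<kappa> (T x) y = \<beta> x y)"
proof -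
  note vs = bilin_vector_spaces(1)[OF \<kappa>]
  have "\<forall>x. \<exists>u. \<forall>y. \<kappa> u y = \<beta> x y"
    using nondegenerate_functional[OF fin \<kappa> nd bilin_linear(2)[OF \<beta>]] by blast
  then obtain T where T: "\<And>x y. \<kappa> (T x) y = \<beta> x y" by metis
  have "Vector_Spaces.linear sK sK T"
    by (rule linearI[OF vs vs]; rule nondegenerate_eqI[OF \<kappa> nd])
      (simp_all add: bilin_eqs[OF \<kappa>] T bilin_eqs[OF \<beta>])
  then show ?thesis using T by blast
qed

section \<open>Vector valued forms\<close>

definition coordinate ::
  "('f::field \<Rightarrow> 'm::ab_group_add \<Rightarrow> 'm) \<Rightarrow> 'm \<Rightarrow> 'm \<Rightarrow> 'f" where
  "coordinate s b v = module.representation s (vector_space.extend_basis s {}) v b"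

lemma extend_basis_empty:
  assumes "vector_space s"
  shows "\<not> module.dependent s (vector_space.extend_basis s {})"
    "module.span s (vector_space.extend_basis s {}) = UNIV"
proof -
  interpret vector_space s by fact
  show "independent (extend_basis {})" "span (extend_basis {}) = UNIV"
    using independent_extend_basis[OF independent_empty] span_extend_basis[OF independent_empty]
    by auto
qed

lemma coordinate_linear:
  assumes "vector_space s"
  shows "Vector_Spaces.linear s (*) (coordinate s b)"
proof -
  interpret vector_space s by fact
  show ?thesis
    by (rule linearI[OF assms vector_space_mult])
      (simp_all add: coordinate_def extend_basis_empty[OF assms] representation_add
        representation_scale)
qed

lemma finite_coordinates:
  assumes "vector_space s"
  shows "finite {b. coordinate s b v \<noteq> 0}"
  unfolding coordinate_def using assms
  by (simp add: module.finite_representation module_iff_vector_space)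

text \<open>
  Allowing a finite set \<open>B\<close> larger than the support lets the values of a whole form
  be expanded over the same \<open>B\<close>.
\<close>
lemma coordinate_expansion:
  assumes s: "vector_space s" and B: "finite B" "{b. coordinate s b v \<noteq> 0} \<subseteq> B"
  shows "(\<Sum>b\<in>B. s (coordinate s b v) b) = v"
proof -
  interpret vector_space s by fact
  have "(\<Sum>b\<in>B. s (coordinate s b v) b) = (\<Sum>b | coordinate s b v \<noteq> 0. s (coordinate s b v) b)"
    by (rule sum.mono_neutral_right) (use B in auto)
  also have "\<dots> = v"
    unfolding coordinate_def
    by (rule sum_nonzero_representation_eq) (simp_all add: extend_basis_empty[OF s])
  finally show ?thesis .
qed

lemma functionals_separate:
  assumes s: "vector_space s" and "\<And>l. Vector_Spaces.linear s (*) l \<Longrightarrow> l v = 0"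
  shows "v = 0"
  using coordinate_expansion[OF s, of "{}" v] assms(2)[OF coordinate_linear[OF s]] by simp

text \<open>
  The values of \<open>\<beta>\<close> on a finite spanning set have finitely many nonzero coordinates altogether,
  and the vectors whose nonzero coordinates lie in a fixed set form a subspace.
\<close>
lemma finitely_many_coordinates:
  assumes fin: "finite_dimensional sK" and \<beta>: "bilin sK sK sM \<beta>"
  shows "\<exists>B. finite B \<and> (\<forall>x y. \<beta> x y = (\<Sum>b\<in>B. sM (coordinate sM b (\<beta> x y)) b))"
proof -
  interpret k: vector_space sK by (rule bilin_vector_spaces(1)[OF \<beta>])
  interpret m: vector_space sM by (rule bilin_vector_spaces(3)[OF \<beta>])
  obtain E where E: "finite E" "k.span E = UNIV" using fin unfolding finite_dimensional_def by blast
  define B where "B = (\<Union>x\<in>E. \<Union>y\<in>E. {b. coordinate sM b (\<beta> x y) \<noteq> 0})"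
  have "finite B" unfolding B_def using E(1) finite_coordinates[OF m.vector_space_axioms] by blast
  moreover
  let ?P = "\<lambda>v. v = (\<Sum>b\<in>B. sM (coordinate sM b v) b)"
  have generators: "?P (\<beta> x y)" if "x \<in> E" "y \<in> E" for x y
    by (rule coordinate_expansion[OF m.vector_space_axioms, symmetric])
      (use \<open>finite B\<close> that in \<open>auto simp: B_def\<close>)
  have combination: "?P (sM c v + w)" if v: "?P v" and w: "?P w" for c v w
  proof -
    have "(\<Sum>b\<in>B. sM (coordinate sM b (sM c v + w)) b)
        = sM c (\<Sum>b\<in>B. sM (coordinate sM b v) b) + (\<Sum>b\<in>B. sM (coordinate sM b w) b)"
      by (simp add: linear_eqs[OF coordinate_linear[OF m.vector_space_axioms]] m.scale_left_distrib sum.distrib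
          m.scale_sum_right)
    then show ?thesis using v w by simp
  qed
  have zero: "?P 0" by (simp add: linear_eqs[OF coordinate_linear[OF m.vector_space_axioms]])
  have generator_left: "?P (\<beta> x y)" if "x \<in> E" for x y
  proof -
    have "y \<in> k.span E" using E by simp
    then show ?thesis
    proof (induction rule: k.span_induct_alt)
      case base then show ?case using zero by (simp add: bilin_eqs[OF \<beta>])
    next
      case (step c e y)
      show ?case unfolding bilin_eqs[OF \<beta>] by (rule combination[OF generators[OF that step(1)] step(2)])
    qed
  qed
  have "?P (\<beta> x y)" for x y
  proof -
    have "x \<in> k.span E" using E by simp
    then show ?thesis
    proof (induction rule: k.span_induct_alt)
      case base then show ?case using zero by (simp add: bilin_eqs[OF \<beta>])
    next
      case (step c e x)
      show ?case unfolding bilin_eqs[OF \<beta>] by (rule combination[OF generator_left[OF step(1)] step(2)])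
    qed
  qed
  ultimately show ?thesis by blast
qed

text \<open>
  Transfers expansions from scalar forms to vector valued ones: expand each of the finitely many
  coordinates of \<open>\<beta>\<close> and collect the coefficients. The map \<open>b\<close> is the bracket when forms are
  expanded up to coboundaries; \<open>b x y = 0\<close> gives expansions without an error term.
\<close>
lemma vector_valued_expansion:
  fixes sK :: "'f::field \<Rightarrow> 'k::ab_group_add \<Rightarrow> 'k" and sM :: "'f \<Rightarrow> 'm::ab_group_add \<Rightarrow> 'm"
  assumes fin: "finite_dimensional sK" and \<beta>: "bilin sK sK sM \<beta>"
    and scalar: "\<And>l. Vector_Spaces.linear sM (*) l \<Longrightarrow>
      \<exists>c g. Vector_Spaces.linear sK (*) g \<and>
        (\<forall>x y. l (\<beta> x y) = (\<Sum>i = 1..n. c i * \<alpha> i x y) + g (b x y))"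
  shows "\<exists>v g. Vector_Spaces.linear sK sM g \<and>
    (\<forall>x y. \<beta> x y = (\<Sum>i = 1..(n::nat). sM (\<alpha> i x y) (v i)) + g (b x y))"
proof -
  interpret m: vector_space sM by (rule bilin_vector_spaces(3)[OF \<beta>])
  obtain B where B: "finite B" "\<And>x y. \<beta> x y = (\<Sum>e\<in>B. sM (coordinate sM e (\<beta> x y)) e)"
    using finitely_many_coordinates[OF fin \<beta>] by blast
  obtain c g where cg: "\<And>e. Vector_Spaces.linear sK (*) (g e)"
    "\<And>e x y. coordinate sM e (\<beta> x y) = (\<Sum>i = 1..n. c e i * \<alpha> i x y) + g e (b x y)"
    using scalar[OF coordinate_linear[OF m.vector_space_axioms]] by metis
  have "Vector_Spaces.linear sK sM (\<lambda>u. \<Sum>e\<in>B. sM (g e u) e)"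
    by (rule linearI[OF bilin_vector_spaces(1,3)[OF \<beta>]])
      (simp_all add: linear_eqs[OF cg(1)] m.scale_left_distrib sum.distrib m.scale_sum_right)
  moreover have "\<beta> x y = (\<Sum>i = 1..n. sM (\<alpha> i x y) (\<Sum>e\<in>B. sM (c e i) e))
      + (\<Sum>e\<in>B. sM (g e (b x y)) e)" for x y
  proof -
    have "\<beta> x y = (\<Sum>e\<in>B. \<Sum>i = 1..n. sM (c e i * \<alpha> i x y) e) + (\<Sum>e\<in>B. sM (g e (b x y)) e)"
      by (subst B(2)) (simp add: cg(2) m.scale_left_distrib sum.distrib m.scale_sum_left)
    also have "(\<Sum>e\<in>B. \<Sum>i = 1..n. sM (c e i * \<alpha> i x y) e)
        = (\<Sum>i = 1..n. sM (\<alpha> i x y) (\<Sum>e\<in>B. sM (c e i) e))"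
      by (subst sum.swap) (simp add: m.scale_sum_right mult.commute)
    finally show ?thesis .
  qed
  ultimately show ?thesis
    by (intro exI[of _ "\<lambda>i. \<Sum>e\<in>B. sM (c e i) e"] exI[of _ "\<lambda>u. \<Sum>e\<in>B. sM (g e u) e"]) blast
qed

lemma forms_basis_independent:
  assumes basis: "forms_basis n \<alpha> W" and sM: "vector_space sM"
    and zero: "\<And>x y. (\<Sum>i = 1..n. sM (\<alpha> i x y) (v i)) = 0"
    and i: "i \<in> {1..n}"
  shows "v i = 0"
proof (rule functionals_separate[OF sM])
  fix l assume l: "Vector_Spaces.linear sM (*) l"
  have "form_lincomb n (\<lambda>i. l (v i)) \<alpha> x y = l (\<Sum>i = 1..n. sM (\<alpha> i x y) (v i))" for x y
    by (simp add: linear_eqs[OF l] form_lincomb_def mult.commute)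
  then have "form_lincomb n (\<lambda>i. l (v i)) \<alpha> = (\<lambda>x y. 0)"
    unfolding zero by (simp add: fun_eq_iff linear_eqs(3)[OF l])
  then show "l (v i) = 0" using basis i unfolding forms_basis_def by blast
qed

section \<open>Forms on perfect Lie superalgebras\<close>

lemma (in lie_superalgebra) coboundary_cocycle:
  assumes g: "Vector_Spaces.linear sK sM g"
  shows "(\<lambda>x y. g (br x y)) \<in> cocycles sK K br sM"
  unfolding cocycles_def
proof (intro CollectI conjI allI ballI)
  show "bilin sK sK sM (\<lambda>x y. g (br x y))" by (rule bilin_linear_comp[OF bracket_bilin g])
  fix p q x y assume xy: "x \<in> K p" "y \<in> K q"
  show "g (br x y) = - sM (psign (p * q)) (g (br y x))"
    by (subst bracket_skew[OF xy]) (simp add: linear_eqs[OF g])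
  show "g (br (br x y) z) = g (br x (br y z)) - sM (psign (p * q)) (g (br y (br x z)))" for z
    by (simp add: bracket_jacobi[OF xy] linear_eqs[OF g])
qed

locale perfect_quadratic = lie_superalgebra sK K br
  for sK :: "'f::field \<Rightarrow> 'k::ab_group_add \<Rightarrow> 'k" and K br +
  fixes \<kappa> :: "'k \<Rightarrow> 'k \<Rightarrow> 'f"
  assumes fin: "finite_dimensional sK" and perf: "perfect sK br"
    and \<kappa>_bilin: "bilin sK sK (*) \<kappa>" and \<kappa>_nondegenerate: "nondegenerate \<kappa>"
    and \<kappa>_invariant: "invariant_form br \<kappa>"
begin

lemma bracket_induct [case_names zero add bracket]:
  assumes "P 0" "\<And>u v. P u \<Longrightarrow> P v \<Longrightarrow> P (u + v)" "\<And>p q x y. x \<in> K p \<Longrightarrow> y \<in> K q \<Longrightarrow> P (br x y)"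
  shows "P u"
proof -
  have br: "P (br x y)" for x y
  proof (induction x rule: homogeneous_induct)
    case (homogeneous p x)
    show ?case
      by (induction y rule: homogeneous_induct)
        (simp_all add: bilin_eqs[OF bracket_bilin] assms(2) assms(3)[OF homogeneous])
  qed (simp add: bilin_eqs[OF bracket_bilin] assms(2))
  have "u \<in> span {br x y | x y. True}" using perf unfolding perfect_def by simp
  then show ?thesis
  proof (induction rule: span_induct_alt)
    case (step c z y)
    then obtain x x' where "z = br x x'" by blast
    then have "sK c z = br (sK c x) x'" by (simp add: bilin_eqs[OF bracket_bilin])
    then show ?case using assms(2) br step by metis
  qed (rule assms(1))
qed

lemma linear_eq_on_brackets:
  assumes "Vector_Spaces.linear sK sM f" "Vector_Spaces.linear sK sM g"
    and "\<And>x y. f (br x y) = g (br x y)"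
  shows "f u = g u"
  by (induction u rule: bracket_induct)
    (simp_all add: linear_eqs[OF assms(1)] linear_eqs[OF assms(2)] assms(3))

text \<open>
  By invariance and skewness of the bracket, \<open>\<alpha>([x,y], z)\<close> changes by the sign rule under
  transposing \<open>x, y\<close> and under transposing \<open>y, z\<close>, hence also under a cyclic shift. As
  \<open>\<alpha>(x, [y,z]) = \<alpha>([x,y], z)\<close>, this is symmetry with a bracket in the second slot, and brackets span.
\<close>
lemma invariant_imp_symmetric:
  assumes \<alpha>: "bilin sK sK sM \<alpha>" and inv: "\<And>x y z. \<alpha> (br x y) z = \<alpha> x (br y z)"
    and xy: "x \<in> K p" "y \<in> K q"
  shows "\<alpha> x y = sM (psign (p * q)) (\<alpha> y x)"
proof -
  interpret m: vector_space sM by (rule bilin_vector_spaces(3)[OF \<alpha>])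
  have skew: "\<alpha> (br x y) z = - sM (psign (p * q)) (\<alpha> (br y x) z)"
    if "x \<in> K p" "y \<in> K q" for p q x y z
    by (subst bracket_skew[OF that]) (simp add: bilin_eqs[OF \<alpha>])
  have flip: "\<alpha> (br x y) z = - sM (psign (q * r)) (\<alpha> (br x z) y)"
    if "y \<in> K q" "z \<in> K r" for q r x y z
    unfolding inv by (subst bracket_skew[OF that]) (simp add: bilin_eqs[OF \<alpha>])
  have triple: "\<alpha> x (br y z) = sM (psign (p * (q + r))) (\<alpha> (br y z) x)"
    if x: "x \<in> K p" and y: "y \<in> K q" and z: "z \<in> K r" for p q r x y z
  proof -
    have "\<alpha> x (br y z) = \<alpha> (br x y) z" by (simp add: inv)
    also have "\<dots> = - sM (psign (p * q)) (\<alpha> (br y x) z)" by (rule skew[OF x y])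
    also have "\<alpha> (br y x) z = - sM (psign (p * r)) (\<alpha> (br y z) x)" by (rule flip[OF x z])
    finally show ?thesis by (simp add: distrib_left psign_add)
  qed
  \<comment> \<open>A homogeneous element is a sum of brackets, but their induction does not stay within
    homogeneous elements. The claim is therefore made for the components of an arbitrary \<open>u\<close>.\<close>
  have "\<forall>p x. x \<in> K p \<longrightarrow> (\<forall>q. \<alpha> x (component q u) = sM (psign (p * q)) (\<alpha> (component q u) x))" for u
  proof (induction u rule: bracket_induct)
    case zero
    then show ?case by (simp add: component_same homogeneous_zero bilin_eqs[OF \<alpha>])
  next
    case (add u v)
    then show ?case by (auto simp: component_add bilin_eqs[OF \<alpha>] m.scale_right_distrib)
  next
    case (bracket r s y z)
    have h: "br y z \<in> K (r + s)" using bracket by (rule bracket_graded)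
    show ?case
    proof (intro allI impI)
      fix p x q assume x: "x \<in> K p"
      consider "q = r + s" | "q = r + s + 1" by (cases q; cases r; cases s; simp)
      then show "\<alpha> x (component q (br y z)) = sM (psign (p * q)) (\<alpha> (component q (br y z)) x)"
        by cases (simp_all add: component_same[OF h] component_other[OF h] bilin_eqs[OF \<alpha>]
            triple[OF x bracket])
    qed
  qed
  then have "\<alpha> x (component q y) = sM (psign (p * q)) (\<alpha> (component q y) x)" using xy by blast
  then show ?thesis using xy by (simp add: component_same)
qed

text \<open>
  The adjoint represents the form obtained from \<open>\<kappa>(Sx, y)\<close> by exchanging the arguments with the
  sign rule. Extended to inhomogeneous elements, the sign is the parity involution applied to
  \<open>x\<close> where \<open>y\<close> is odd.
\<close>
lemma super_adjoint_eq:
  assumes S: "Vector_Spaces.linear sK sK S" and xy: "x \<in> K p" "y \<in> K q"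
  shows "\<kappa> (S x) y = psign (p * q) * \<kappa> (super_adjoint sK K \<kappa> S y) x"
proof -
  let ?adj = "\<lambda>T. Vector_Spaces.linear sK sK T \<and>
     (\<forall>p q. \<forall>x\<in>K p. \<forall>y\<in>K q. \<kappa> (S x) y = psign (p * q) * \<kappa> (T y) x)"
  define \<beta> where "\<beta> y x = \<kappa> (S x) (component 0 y) + \<kappa> (S (parity_involution x)) (component 1 y)" for y x
  have "bilin sK sK (*) \<beta>"
    by (rule bilinI[OF vector_space_axioms vector_space_axioms vector_space_mult])
      (simp_all add: \<beta>_def component_add component_scale parity_involution_add
        parity_involution_scale linear_eqs[OF S] bilin_eqs[OF \<kappa>_bilin] algebra_simps)
  then obtain T where T: "Vector_Spaces.linear sK sK T" "\<And>x y. \<kappa> (T x) y = \<beta> x y"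
    using nondegenerate_form[OF fin \<kappa>_bilin \<kappa>_nondegenerate] by blast
  have "?adj T"
  proof (intro conjI T(1) allI ballI)
    fix p q x y assume x: "x \<in> K p" and y: "y \<in> K q"
    have "\<beta> y x = psign (p * q) * \<kappa> (S x) y"
      using component_same[OF y] component_other[OF y]
      by (cases q)
        (simp_all add: \<beta>_def parity_involution_homogeneous[OF x] linear_eqs[OF S] bilin_eqs[OF \<kappa>_bilin])
    then show "\<kappa> (S x) y = psign (p * q) * \<kappa> (T y) x" by (simp add: T(2))
  qed
  moreover have "T' = T" if "?adj T'" for T'
  proof
    fix y
    have "\<kappa> (T' y) x = \<kappa> (T y) x" for x
    proof (induction y rule: homogeneous_induct)
      case (homogeneous q y)
      then show ?case
      proof (induction x rule: homogeneous_induct)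
        case (homogeneous p x)
        then have "psign (p * q) * \<kappa> (T' y) x = psign (p * q) * \<kappa> (T y) x"
          using that \<open>?adj T\<close> by metis
        then show ?case by simp
      qed (simp add: bilin_eqs[OF \<kappa>_bilin])
    next
      case (add u v)
      have T': "Vector_Spaces.linear sK sK T'" using that by blast
      from add show ?case
        by (simp add: linear_eqs[OF T(1)] linear_eqs[OF T'] bilin_eqs[OF \<kappa>_bilin])
    qed
    then show "T' y = T y" by (rule nondegenerate_eqI[OF \<kappa>_bilin \<kappa>_nondegenerate])
  qed
  ultimately have "?adj (super_adjoint sK K \<kappa> S)"
    unfolding super_adjoint_def by (rule theI)
  then show ?thesis using xy by blast
qed

text \<open>
  The second cocycle identity alone says that the endomorphism \<open>D\<close> representing \<open>\<beta>\<close> is a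
  derivation. Derivation invariance of \<open>\<kappa>\<close> turns this into \<open>D\<^sup>* = -D\<close>, which is the skewness of \<open>\<beta>\<close>.
\<close>
lemma derivation_form_cocycle:
  assumes inv: "derivation_invariant sK K br \<kappa>" and \<beta>: "bilin sK sK (*) \<beta>"
    and deriv: "\<And>p q x y z. x \<in> K p \<Longrightarrow> y \<in> K q \<Longrightarrow>
      \<beta> (br x y) z = \<beta> x (br y z) - psign (p * q) * \<beta> y (br x z)"
  shows "\<beta> \<in> cocycles sK K br (*)"
proof -
  obtain D where D: "Vector_Spaces.linear sK sK D" "\<And>x y. \<kappa> (D x) y = \<beta> x y"
    using nondegenerate_form[OF fin \<kappa>_bilin \<kappa>_nondegenerate \<beta>] by blast
  have \<kappa>_inv: "\<kappa> (br x y) z = \<kappa> x (br y z)" for x y z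
    using \<kappa>_invariant unfolding invariant_form_def by blast
  have "D \<in> der sK K br"
    unfolding der_def
  proof (intro CollectI conjI D(1) allI ballI)
    fix p q x y assume xy: "x \<in> K p" "y \<in> K q"
    show "D (br x y) = br (D x) y - sK (psign (p * q)) (br (D y) x)"
      by (rule nondegenerate_eqI[OF \<kappa>_bilin \<kappa>_nondegenerate])
        (simp add: bilin_eqs[OF \<kappa>_bilin] \<kappa>_inv D(2) deriv[OF xy])
  qed
  then have "super_adjoint sK K \<kappa> D = (\<lambda>x. - D x)"
    using inv unfolding derivation_invariant_def der_minus_def by blast
  then have "\<beta> x y = - (psign (p * q) * \<beta> y x)" if "x \<in> K p" "y \<in> K q" for p q x y
    using super_adjoint_eq[OF D(1) that] by (simp add: bilin_eqs[OF \<kappa>_bilin] D(2))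
  then show ?thesis unfolding cocycles_def using \<beta> deriv by blast
qed

lemma H2_basis_spans:
  assumes basis: "H2_basis sK K br n \<alpha>" and \<beta>: "\<beta> \<in> cocycles sK K br (*)"
  shows "\<exists>c g. Vector_Spaces.linear sK (*) g \<and>
    (\<forall>x y. \<beta> x y = (\<Sum>i = 1..n. c i * \<alpha> i x y) + g (br x y))"
proof -
  have zero: "(\<lambda>x y. 0) \<in> coboundaries sK br (*)"
    unfolding coboundaries_def
    by (intro CollectI exI[of _ "\<lambda>x. 0"] conjI linearI[OF vector_space_axioms vector_space_mult])
      simp_all
  have "coh_class sK K br (*) \<beta> \<in> H2 sK K br (*)"
    unfolding H2_def coh_class_def using \<beta> by (rule quotientI)
  then obtain c where c: "coh_class sK K br (*) \<beta> = coh_class sK K br (*) (form_lincomb n c \<alpha>)"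
    using basis unfolding H2_basis_def by blast
  have "\<beta> \<in> coh_class sK K br (*) \<beta>"
    using \<beta> zero by (simp add: coh_class_def cohomologous_def)
  then have "(\<lambda>x y. form_lincomb n c \<alpha> x y - \<beta> x y) \<in> coboundaries sK br (*)"
    unfolding c by (simp add: coh_class_def cohomologous_def)
  then obtain f where f: "Vector_Spaces.linear sK (*) f"
    "\<And>x y. form_lincomb n c \<alpha> x y - \<beta> x y = f (br x y)"
    unfolding coboundaries_def by (auto simp: fun_eq_iff)
  have "Vector_Spaces.linear sK (*) (\<lambda>x. - f x)"
    by (rule linearI[OF vector_space_axioms vector_space_mult]) (simp_all add: linear_eqs[OF f(1)])
  moreover have "\<beta> x y = (\<Sum>i = 1..n. c i * \<alpha> i x y) + - f (br x y)" for x y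
    using f(2)[of x y] by (simp add: form_lincomb_def algebra_simps)
  ultimately show ?thesis by blast
qed

lemma cocycle_combination:
  assumes "\<And>i. i \<in> {1..n} \<Longrightarrow> \<alpha> i \<in> cocycles sK K br (*)"
  shows "form_lincomb n c \<alpha> \<in> cocycles sK K br (*)"
proof -
  have bil: "bilin sK sK (*) (\<alpha> i)" if "i \<in> {1..n}" for i
    using assms[OF that] by (simp add: cocycles_def)
  have "bilin sK sK (*) (\<lambda>x y. c i * \<alpha> i x y)" if "i \<in> {1..n}" for i
    by (rule bilinI[OF vector_space_axioms vector_space_axioms vector_space_mult])
      (simp_all add: bilin_eqs[OF bil[OF that]] algebra_simps)
  then have "bilin sK sK (*) (form_lincomb n c \<alpha>)"
    unfolding form_lincomb_def
    by (intro bilin_sum vector_space_axioms vector_space_mult)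
  moreover have "form_lincomb n c \<alpha> x y = - (psign (p * q) * form_lincomb n c \<alpha> y x)"
    if xy: "x \<in> K p" "y \<in> K q" for p q x y
  proof -
    have "\<alpha> i x y = - (psign (p * q) * \<alpha> i y x)" if "i \<in> {1..n}" for i
      using assms[OF that] xy unfolding cocycles_def by blast
    then have "(\<Sum>i = 1..n. c i * \<alpha> i x y) = (\<Sum>i = 1..n. c i * - (psign (p * q) * \<alpha> i y x))"
      by (intro sum.cong) simp_all
    then show ?thesis
      by (simp add: form_lincomb_def sum_distrib_left sum_negf mult.left_commute)
  qed
  moreover have "form_lincomb n c \<alpha> (br x y) z
      = form_lincomb n c \<alpha> x (br y z) - psign (p * q) * form_lincomb n c \<alpha> y (br x z)"
    if xy: "x \<in> K p" "y \<in> K q" for p q x y z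
  proof -
    have "\<alpha> i (br x y) z = \<alpha> i x (br y z) - psign (p * q) * \<alpha> i y (br x z)" if "i \<in> {1..n}" for i
      using assms[OF that] xy unfolding cocycles_def by blast
    then have "(\<Sum>i = 1..n. c i * \<alpha> i (br x y) z)
        = (\<Sum>i = 1..n. c i * (\<alpha> i x (br y z) - psign (p * q) * \<alpha> i y (br x z)))"
      by (intro sum.cong) simp_all
    then show ?thesis
      by (simp add: form_lincomb_def sum_distrib_left sum_subtractf right_diff_distrib mult.left_commute)
  qed
  ultimately show ?thesis unfolding cocycles_def by blast
qed

text \<open>
  A relation modulo coboundaries between vector valued forms becomes, under each functional, a
  relation between cohomology classes; functionals separate vectors.
\<close>
lemma H2_basis_independent:
  assumes basis: "H2_basis sK K br n \<alpha>" and sM: "vector_space sM"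
    and g: "Vector_Spaces.linear sK sM g"
    and zero: "\<And>x y. (\<Sum>i = 1..n. sM (\<alpha> i x y) (v i)) + g (br x y) = 0"
    and i: "i \<in> {1..n}"
  shows "v i = 0"
proof (rule functionals_separate[OF sM])
  fix l assume l: "Vector_Spaces.linear sM (*) l"
  let ?c = "\<lambda>i. l (v i)"
  let ?\<beta> = "form_lincomb n ?c \<alpha>"
  have \<beta>: "?\<beta> x y = - l (g (br x y))" for x y
  proof -
    have "0 = l ((\<Sum>i = 1..n. sM (\<alpha> i x y) (v i)) + g (br x y))" unfolding zero by (simp add: linear_eqs[OF l])
    also have "\<dots> = ?\<beta> x y + l (g (br x y))"
      by (simp add: linear_eqs[OF l] form_lincomb_def mult.commute)
    finally show ?thesis by (simp add: eq_neg_iff_add_eq_0)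
  qed
  have shift: "(\<lambda>x y. f (br x y) + h (br x y)) \<in> coboundaries sK br (*)"
    if "Vector_Spaces.linear sK (*) f" "Vector_Spaces.linear sK (*) h" for f h :: "'k \<Rightarrow> 'f"
    unfolding coboundaries_def
    by (intro CollectI exI[of _ "\<lambda>x. f x + h x"] conjI refl
        linearI[OF vector_space_axioms vector_space_mult])
      (simp_all add: linear_eqs[OF that(1)] linear_eqs[OF that(2)] algebra_simps)
  have lg: "Vector_Spaces.linear sK (*) (\<lambda>x. l (g x))" by (rule linear_comp[OF g l])
  have nlg: "Vector_Spaces.linear sK (*) (\<lambda>x. - l (g x))"
    by (rule linearI[OF vector_space_axioms vector_space_mult]) (simp_all add: linear_eqs[OF lg])
  have "(\<lambda>x y. ?\<beta> x y - \<omega> x y) \<in> coboundaries sK br (*)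
    \<longleftrightarrow> (\<lambda>x y. 0 - \<omega> x y) \<in> coboundaries sK br (*)" for \<omega>
  proof
    assume "(\<lambda>x y. ?\<beta> x y - \<omega> x y) \<in> coboundaries sK br (*)"
    then obtain f where f: "Vector_Spaces.linear sK (*) f" "\<And>x y. ?\<beta> x y - \<omega> x y = f (br x y)"
      unfolding coboundaries_def by (auto simp: fun_eq_iff)
    have "(\<lambda>x y. 0 - \<omega> x y) = (\<lambda>x y. f (br x y) + l (g (br x y)))"
      by (intro ext) (simp only: f(2)[symmetric] \<beta>, simp)
    then show "(\<lambda>x y. 0 - \<omega> x y) \<in> coboundaries sK br (*)" using shift[OF f(1) lg] by simp
  next
    assume "(\<lambda>x y. 0 - \<omega> x y) \<in> coboundaries sK br (*)"
    then obtain f where f: "Vector_Spaces.linear sK (*) f" "\<And>x y. 0 - \<omega> x y = f (br x y)"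
      unfolding coboundaries_def by (auto simp: fun_eq_iff)
    have "(\<lambda>x y. ?\<beta> x y - \<omega> x y) = (\<lambda>x y. f (br x y) + - l (g (br x y)))"
      by (intro ext) (simp only: \<beta> f(2)[symmetric], simp)
    then show "(\<lambda>x y. ?\<beta> x y - \<omega> x y) \<in> coboundaries sK br (*)" using shift[OF f(1) nlg] by simp
  qed
  moreover have "?\<beta> \<in> cocycles sK K br (*)"
    using basis unfolding H2_basis_def by (intro cocycle_combination) blast
  moreover have "(\<lambda>x y. 0) \<in> cocycles sK K br (*)"
    using cocycle_combination[of 0 \<alpha>] by (simp add: form_lincomb_def)
  ultimately have "coh_class sK K br (*) ?\<beta> = coh_class sK K br (*) (\<lambda>x y. 0)"
    by (auto simp: coh_class_def cohomologous_def)
  then show "l (v i) = 0" using basis i unfolding H2_basis_def by blast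
qed

lemma cocycle_functional:
  assumes \<beta>: "\<beta> \<in> cocycles sK K br sM" and l: "Vector_Spaces.linear sM (*) l"
  shows "(\<lambda>x y. l (\<beta> x y)) \<in> cocycles sK K br (*)"
proof -
  have bil: "bilin sK sK sM \<beta>"
    and skew: "\<beta> x y = - sM (psign (p * q)) (\<beta> y x)"
    and cocycle: "\<beta> (br x y) z = \<beta> x (br y z) - sM (psign (p * q)) (\<beta> y (br x z))"
    if "x \<in> K p" "y \<in> K q" for p q x y z
    using \<beta> that unfolding cocycles_def by blast+
  show ?thesis
    unfolding cocycles_def
  proof (intro CollectI conjI allI ballI)
    show "bilin sK sK (*) (\<lambda>x y. l (\<beta> x y))"
      by (rule bilin_linear_comp[OF bil[OF homogeneous_zero homogeneous_zero] l])
    fix p q x y assume xy: "x \<in> K p" "y \<in> K q"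
    show "l (\<beta> x y) = - (psign (p * q) * l (\<beta> y x))"
      by (subst skew[OF xy]) (simp add: linear_eqs[OF l])
    show "l (\<beta> (br x y) z) = l (\<beta> x (br y z)) - psign (p * q) * l (\<beta> y (br x z))" for z
      by (subst cocycle[OF xy]) (simp add: linear_eqs[OF l])
  qed
qed

lemma vector_valued_derivation_form_cocycle:
  assumes inv: "derivation_invariant sK K br \<kappa>" and \<beta>: "bilin sK sK sM \<beta>"
    and deriv: "\<And>p q x y z. x \<in> K p \<Longrightarrow> y \<in> K q \<Longrightarrow>
      \<beta> (br x y) z = \<beta> x (br y z) - sM (psign (p * q)) (\<beta> y (br x z))"
  shows "\<beta> \<in> cocycles sK K br sM"
proof -
  have "\<beta> x y = - sM (psign (p * q)) (\<beta> y x)" if xy: "x \<in> K p" "y \<in> K q" for p q x y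
  proof -
    have "\<beta> x y + sM (psign (p * q)) (\<beta> y x) = 0"
    proof (rule functionals_separate[OF bilin_vector_spaces(3)[OF \<beta>]])
      fix l assume l: "Vector_Spaces.linear sM (*) l"
      have "(\<lambda>x y. l (\<beta> x y)) \<in> cocycles sK K br (*)"
        by (rule derivation_form_cocycle[OF inv bilin_linear_comp[OF \<beta> l]])
          (simp add: deriv linear_eqs[OF l])
      then have "l (\<beta> x y) = - (psign (p * q) * l (\<beta> y x))"
        using xy unfolding cocycles_def by blast
      then show "l (\<beta> x y + sM (psign (p * q)) (\<beta> y x)) = 0" by (simp add: linear_eqs[OF l])
    qed
    then show ?thesis by (simp add: eq_neg_iff_add_eq_0)
  qed
  then show ?thesis unfolding cocycles_def using \<beta> deriv by blast
qed

lemma vector_valued_cocycle_decomposition: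
  assumes basis: "H2_basis sK K br n \<alpha>" and \<beta>: "\<beta> \<in> cocycles sK K br sM"
  shows "\<exists>v g. Vector_Spaces.linear sK sM g \<and>
    (\<forall>x y. \<beta> x y = (\<Sum>i = 1..n. sM (\<alpha> i x y) (v i)) + g (br x y))"
proof (rule vector_valued_expansion[OF fin])
  show "bilin sK sK sM \<beta>" using \<beta> by (simp add: cocycles_def)
  show "\<exists>c g. Vector_Spaces.linear sK (*) g \<and>
      (\<forall>x y. l (\<beta> x y) = (\<Sum>i = 1..n. c i * \<alpha> i x y) + g (br x y))"
    if "Vector_Spaces.linear sM (*) l" for l
    by (rule H2_basis_spans[OF basis cocycle_functional[OF \<beta> that]])
qed

text \<open>
  The scalar coordinates of \<open>\<beta>\<close> are invariant and, \<open>K\<close> being perfect, therefore supersymmetric,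
  so they lie in the span of the \<open>\<alpha>\<^sub>j\<close>.
\<close>
lemma vector_valued_invariant_decomposition:
  assumes basis: "forms_basis n \<alpha> (invariant_forms sK K br)"
    and \<beta>: "bilin sK sK sM \<beta>" and inv: "\<And>x y z. \<beta> (br x y) z = \<beta> x (br y z)"
  shows "\<exists>v. \<forall>x y. \<beta> x y = (\<Sum>i = 1..n. sM (\<alpha> i x y) (v i))"
proof -
  have "\<exists>v g. Vector_Spaces.linear sK sM g \<and>
    (\<forall>x y. \<beta> x y = (\<Sum>i = 1..n. sM (\<alpha> i x y) (v i)) + g 0)"
  proof (rule vector_valued_expansion[OF fin \<beta>])
    fix l assume l: "Vector_Spaces.linear sM (*) l"
    let ?l\<beta> = "\<lambda>x y. l (\<beta> x y)"
    note l\<beta> = bilin_linear_comp[OF \<beta> l]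
    have "?l\<beta> \<in> invariant_forms sK K br"
      unfolding invariant_forms_def supersymmetric_def invariant_form_def
    proof (intro CollectI conjI allI ballI l\<beta>)
      fix p q x y assume "x \<in> K p" "y \<in> K q"
      then show "l (\<beta> x y) = psign (p * q) * l (\<beta> y x)"
        by (rule invariant_imp_symmetric[OF l\<beta>, rotated]) (simp add: inv)
    qed (simp add: inv)
    then obtain c where "?l\<beta> = form_lincomb n c \<alpha>" using basis unfolding forms_basis_def by blast
    then have "l (\<beta> x y) = (\<Sum>i = 1..n. c i * \<alpha> i x y) + 0" for x y
      by (simp add: form_lincomb_def fun_eq_iff)
    moreover have "Vector_Spaces.linear sK (*) (\<lambda>x. 0 :: 'f)"
      by (rule linearI[OF vector_space_axioms vector_space_mult]) simp_all
    ultimately show "\<exists>c g. Vector_Spaces.linear sK (*) g \<and>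
      (\<forall>x y. l (\<beta> x y) = (\<Sum>i = 1..n. c i * \<alpha> i x y) + g 0)"
      by (intro exI[of _ c] exI[of _ "\<lambda>x. 0"]) blast
  qed
  then obtain v g where vg: "Vector_Spaces.linear sK sM g"
    "\<And>x y. \<beta> x y = (\<Sum>i = 1..n. sM (\<alpha> i x y) (v i)) + g 0" by blast
  then show ?thesis using linear_eqs(3)[OF vg(1)] by auto
qed

end

section \<open>Tensor products\<close>

lemma lookup_free_scale [simp]:
  "Poly_Mapping.lookup (free_scale c u) k = c * Poly_Mapping.lookup u k"
  by (simp add: free_scale_def Poly_Mapping.map.rep_eq when_def)

lemma vector_space_free_scale: "vector_space (free_scale :: 'f::field \<Rightarrow> _)"
  by unfold_locales (simp_all add: poly_mapping_eq_iff fun_eq_iff lookup_add algebra_simps)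

lemma free_lift_superset:
  assumes "vector_space sV" "finite S" "Poly_Mapping.keys u \<subseteq> S"
  shows "free_lift sV \<beta> u = (\<Sum>k\<in>S. sV (Poly_Mapping.lookup u k) (\<beta> (fst k) (snd k)))"
proof -
  interpret vector_space sV by fact
  have "free_lift sV \<beta> u
      = (\<Sum>k\<in>Poly_Mapping.keys u. sV (Poly_Mapping.lookup u k) (\<beta> (fst k) (snd k)))"
    by (simp add: free_lift_def case_prod_unfold)
  also have "\<dots> = (\<Sum>k\<in>S. sV (Poly_Mapping.lookup u k) (\<beta> (fst k) (snd k)))"
    by (rule sum.mono_neutral_left) (use assms in \<open>auto simp: in_keys_iff\<close>)
  finally show ?thesis .
qed

lemma free_lift_linear:
  fixes sV :: "'f::field \<Rightarrow> 'v::ab_group_add \<Rightarrow> 'v" and \<beta> :: "'a \<Rightarrow> 'k \<Rightarrow> 'v"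
  assumes "vector_space sV"
  shows "Vector_Spaces.linear free_scale sV (free_lift sV \<beta>)"
proof (rule linearI[OF vector_space_free_scale assms])
  interpret vector_space sV by fact
  fix u v :: "'a \<times> 'k \<Rightarrow>\<^sub>0 'f" and c :: 'f
  let ?S = "Poly_Mapping.keys u \<union> Poly_Mapping.keys v"
  have "finite ?S" "Poly_Mapping.keys (u + v) \<subseteq> ?S" by (simp_all add: keys_add)
  then have "free_lift sV \<beta> w = (\<Sum>k\<in>?S. sV (Poly_Mapping.lookup w k) (\<beta> (fst k) (snd k)))"
    if "w \<in> {u, v, u + v}" for w
    using that by (intro free_lift_superset[OF assms]) auto
  then show "free_lift sV \<beta> (u + v) = free_lift sV \<beta> u + free_lift sV \<beta> v"
    by (simp add: lookup_add scale_left_distrib sum.distrib)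
  have "Poly_Mapping.keys (free_scale c u) \<subseteq> Poly_Mapping.keys u"
    by (auto simp: in_keys_iff)
  then show "free_lift sV \<beta> (free_scale c u) = sV c (free_lift sV \<beta> u)"
    by (simp add: free_lift_superset[OF assms finite_keys order_refl, where u = u]
        free_lift_superset[OF assms finite_keys[of u]] scale_sum_right)
qed

lemma free_lift_single [simp]:
  assumes "vector_space sV"
  shows "free_lift sV \<beta> (Poly_Mapping.single (a, x) 1) = \<beta> a x"
proof -
  interpret vector_space sV by fact
  show ?thesis by (simp add: free_lift_def)
qed

text \<open>
  The universal property: the lift of \<open>\<beta>\<close> to the free vector space kills the bilinearity
  relations, so it factors through the tensor product.
\<close>
lemma tensor_lift_exists:
  assumes T: "tensor_product sA sK sT tens" and \<beta>: "bilin sA sK sV \<beta>"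
  shows "\<exists>L. Vector_Spaces.linear sT sV L \<and> (\<forall>a x. L (tens a x) = \<beta> a x)"
proof -
  note vV = bilin_vector_spaces(3)[OF \<beta>]
  have vT: "vector_space sT" using T by (simp add: tensor_product_def)
  interpret free: vector_space free_scale by (rule vector_space_free_scale)
  let ?q = "free_lift sT tens" and ?b = "free_lift sV \<beta>"
  note q = linear_eqs[OF free_lift_linear[OF vT]] and b = linear_eqs[OF free_lift_linear[OF vV]]
  have rel: "?b u = 0" if "u \<in> bilinearity_relations sA sK" for u
    using that unfolding bilinearity_relations_def
    by (auto simp: b vV bilin_eqs[OF \<beta>])
  have ker: "?b u = 0" if "?q u = 0" for u
  proof -
    have "u \<in> free.span (bilinearity_relations sA sK)" using that T by (auto simp: tensor_product_def)
    then show ?thesis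
      by (induction rule: free.span_induct_alt)
        (simp_all add: b rel module.scale_zero_right[OF vV[folded module_iff_vector_space]])
  qed
  have wd: "?b u = ?b v" if "?q u = ?q v" for u v
    using ker[of "u - v"] that by (simp add: q b)
  define L where "L w = ?b (inv ?q w)" for w
  have qinv: "?q (inv ?q w) = w" for w
    using T by (simp add: tensor_product_def surj_f_inv_f)
  have L: "L (?q u) = ?b u" for u
    unfolding L_def by (rule wd) (rule qinv)
  have "Vector_Spaces.linear sT sV L"
  proof (rule linearI[OF vT vV])
    fix w w' c
    have "L (w + w') = L (?q (inv ?q w + inv ?q w'))" by (simp add: q qinv)
    then show "L (w + w') = L w + L w'" unfolding L by (simp add: b L_def)
    have "L (sT c w) = L (?q (free_scale c (inv ?q w)))" by (simp add: q qinv)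
    then show "L (sT c w) = sV c (L w)" unfolding L by (simp add: b L_def)
  qed
  moreover have "L (tens a x) = \<beta> a x" for a x
    using L[of "Poly_Mapping.single (a, x) 1"] by (simp add: vT vV)
  ultimately show ?thesis by blast
qed

lemma tensor_bilin:
  assumes T: "tensor_product sA sK sT tens" and vA: "vector_space sA" and vK: "vector_space sK"
  shows "bilin sA sK sT tens"
proof -
  have vT: "vector_space sT" using T by (simp add: tensor_product_def)
  interpret free: vector_space free_scale by (rule vector_space_free_scale)
  note q = linear_eqs[OF free_lift_linear[OF vT]]
  have rel: "free_lift sT tens u = 0" if "u \<in> bilinearity_relations sA sK" for u
    using free.span_base[OF that] T by (auto simp: tensor_product_def)
  show ?thesis
  proof (rule bilinI[OF vA vK vT])
    fix a b x y c
    have "free_lift sT tens (Poly_Mapping.single (a + b, x) 1 - Poly_Mapping.single (a, x) 1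
        - Poly_Mapping.single (b, x) 1) = 0"
      unfolding bilinearity_relations_def by (rule rel[unfolded bilinearity_relations_def]) blast
    then show "tens (a + b) x = tens a x + tens b x" by (simp add: q vT algebra_simps)
    have "free_lift sT tens (Poly_Mapping.single (a, x + y) 1 - Poly_Mapping.single (a, x) 1
        - Poly_Mapping.single (a, y) 1) = 0"
      unfolding bilinearity_relations_def by (rule rel[unfolded bilinearity_relations_def]) blast
    then show "tens a (x + y) = tens a x + tens a y" by (simp add: q vT algebra_simps)
    have "free_lift sT tens
        (Poly_Mapping.single (sA c a, x) 1 - free_scale c (Poly_Mapping.single (a, x) 1)) = 0"
      unfolding bilinearity_relations_def by (rule rel[unfolded bilinearity_relations_def]) blast
    then show "tens (sA c a) x = sT c (tens a x)" by (simp add: q vT)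
    have "free_lift sT tens
        (Poly_Mapping.single (a, sK c x) 1 - free_scale c (Poly_Mapping.single (a, x) 1)) = 0"
      unfolding bilinearity_relations_def by (rule rel[unfolded bilinearity_relations_def]) blast
    then show "tens a (sK c x) = sT c (tens a x)" by (simp add: q vT)
  qed
qed

lemma tensor_induct:
  assumes T: "tensor_product sA sK sT tens" and vA: "vector_space sA" and vK: "vector_space sK"
    and P: "\<And>u v. P u \<Longrightarrow> P v \<Longrightarrow> P (u + v)" "\<And>a x. P (tens a x)"
  shows "P w"
proof -
  note tens = bilin_eqs[OF tensor_bilin[OF T vA vK]]
  obtain u where u: "w = free_lift sT tens u"
    using T by (auto simp: tensor_product_def surj_def)
  have zero: "P 0" using P(2)[of 0 0] by (simp add: tens)
  have "P (\<Sum>k\<in>S. sT (h k) (tens (fst k) (snd k)))" if "finite S" for S h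
    using that
  proof induction
    case (insert k S)
    have "P (sT (h k) (tens (fst k) (snd k)))"
      unfolding tens(3)[symmetric] by (rule P(2))
    then show ?case using insert P(1) by simp
  qed (simp add: zero)
  then show ?thesis unfolding u by (simp add: free_lift_def case_prod_unfold)
qed

lemma tensor_linear_eqI:
  assumes T: "tensor_product sA sK sT tens" and vA: "vector_space sA" and vK: "vector_space sK"
    and f: "Vector_Spaces.linear sT sV f" and g: "Vector_Spaces.linear sT sV g"
    and eq: "\<And>a x. f (tens a x) = g (tens a x)"
  shows "f w = g w"
  by (rule tensor_induct[OF T vA vK, of "\<lambda>w. f w = g w"])
    (simp_all add: eq linear_eqs[OF f] linear_eqs[OF g])

text \<open>
  The universal property is applied in one pair of variables at a time. That the second
  application is legitimate, and that the result is linear in the first argument, follows from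
  the uniqueness of lifts.
\<close>
lemma tensor_bilin_lift_exists:
  assumes T: "tensor_product sA sK sT tens"
    and R1: "\<And>b y. bilin sA sK sV (\<lambda>a x. R a x b y)" and R2: "\<And>a x. bilin sA sK sV (R a x)"
  shows "\<exists>h. bilin sT sT sV h \<and> (\<forall>a x b y. h (tens a x) (tens b y) = R a x b y)"
proof -
  note v = bilin_vector_spaces[OF R1]
  have vT: "vector_space sT" using T by (simp add: tensor_product_def)
  interpret V: vector_space sV by (rule v)
  note eqI = tensor_linear_eqI[OF T v(1,2)]
  obtain l where l: "\<And>b y. Vector_Spaces.linear sT sV (l b y)"
    "\<And>b y a x. l b y (tens a x) = R a x b y"
    using tensor_lift_exists[OF T R1] by metis
  have lin: "Vector_Spaces.linear sT sV (\<lambda>u. l b y u + l b' y' u)"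
    "Vector_Spaces.linear sT sV (\<lambda>u. sV c (l b y u))" for b y b' y' c
    by (rule linearI[OF vT v(3)];
        simp add: linear_eqs[OF l(1)] V.scale_right_distrib mult.commute add_ac)+
  have bil: "bilin sA sK sV (\<lambda>b y. l b y u)" for u
    by (rule bilinI[OF v];
        rule eqI[OF l(1)], rule lin, simp add: l(2) bilin_eqs[OF R2])
  obtain h where h: "\<And>u. Vector_Spaces.linear sT sV (h u)" "\<And>u b y. h u (tens b y) = l b y u"
    using tensor_lift_exists[OF T bil] by metis
  have hlin: "Vector_Spaces.linear sT sV (\<lambda>w. h u w + h u' w)"
    "Vector_Spaces.linear sT sV (\<lambda>w. sV c (h u w))" for u u' c
    by (rule linearI[OF vT v(3)];
        simp add: linear_eqs[OF h(1)] V.scale_right_distrib mult.commute add_ac)+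
  have "bilin sT sT sV h"
  proof (rule bilinI[OF vT vT v(3)])
    show "h (u + u') w = h u w + h u' w" for u u' w
      by (rule eqI[OF h(1)], rule hlin, simp add: h(2) linear_eqs[OF l(1)])
    show "h (sT c u) w = sV c (h u w)" for c u w
      by (rule eqI[OF h(1)], rule hlin, simp add: h(2) linear_eqs[OF l(1)])
  qed (simp_all add: linear_eqs[OF h(1)])
  then show ?thesis using h(2) l(2) by auto
qed

section \<open>Forms on current superalgebras\<close>

text \<open>
  Parity shows that multiplication by the odd component of the unit annihilates every
  homogeneous \<open>b\<close>, because both \<open>b\<close> and \<open>b\<close> times the even component have the parity of \<open>b\<close>.
\<close>
lemma (in supercommutative_superalgebra) one_even: "1 \<in> A 0"
proof -
  note e = bilin_eqs[OF mult_bilin]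
  have "b * component 1 1 = 0" for b
  proof (induction b rule: homogeneous_induct)
    case (homogeneous p b)
    have "b * component 1 1 \<in> A (p + 1)" using homogeneous by (simp add: mult_graded)
    moreover have "b * component 0 1 \<in> A p" using mult_graded[OF homogeneous, of _ 0] by simp
    moreover have "b * component 1 1 = b - b * component 0 1"
      using component_decomp[of 1] by (simp add: algebra_simps flip: e(2))
    ultimately show ?case using homogeneous homogeneous_diff homogeneous_disjoint by metis
  qed (simp add: e)
  from this[of 1] have "component 1 1 = 0" by simp
  then show ?thesis using component_decomp[of 1] component_mem[of 0 1] by simp
qed

definition quadrilinear ::
  "('f::field \<Rightarrow> 'a::ab_group_add \<Rightarrow> 'a) \<Rightarrow> ('f \<Rightarrow> 'k::ab_group_add \<Rightarrow> 'k) \<Rightarrow>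
   ('f \<Rightarrow> 'm::ab_group_add \<Rightarrow> 'm) \<Rightarrow> ('a \<Rightarrow> 'a \<Rightarrow> 'k \<Rightarrow> 'k \<Rightarrow> 'm) \<Rightarrow> bool" where
  "quadrilinear sA sK sM Q \<longleftrightarrow>
     (\<forall>x y. bilin sA sA sM (\<lambda>a b. Q a b x y)) \<and> (\<forall>a b. bilin sK sK sM (Q a b))"

lemma quadrilinear_eqs:
  assumes "quadrilinear sA sK sM Q"
  shows "Q (a + a') b x y = Q a b x y + Q a' b x y" "Q (sA c a) b x y = sM c (Q a b x y)"
    "Q a (b + b') x y = Q a b x y + Q a b' x y" "Q a (sA c b) x y = sM c (Q a b x y)"
    "Q a b (x + x') y = Q a b x y + Q a b x' y" "Q a b (sK c x) y = sM c (Q a b x y)"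
    "Q a b x (y + y') = Q a b x y + Q a b x y'" "Q a b x (sK c y) = sM c (Q a b x y)"
    "Q a b (- x) y = - Q a b x y" "Q a b x (- y) = - Q a b x y"
    "Q a b 0 y = 0" "Q a b x 0 = 0" "Q 0 b x y = 0" "Q a 0 x y = 0"
proof -
  have 1: "bilin sA sA sM (\<lambda>a b. Q a b x y)" and 2: "bilin sK sK sM (Q a b)" for a b x y
    using assms by (simp_all add: quadrilinear_def)
  show "Q (a + a') b x y = Q a b x y + Q a' b x y" "Q (sA c a) b x y = sM c (Q a b x y)"
    "Q a (b + b') x y = Q a b x y + Q a b' x y" "Q a (sA c b) x y = sM c (Q a b x y)"
    "Q 0 b x y = 0" "Q a 0 x y = 0"
    by (simp_all add: bilin_eqs[OF 1])
  show "Q a b (x + x') y = Q a b x y + Q a b x' y" "Q a b (sK c x) y = sM c (Q a b x y)"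
    "Q a b x (y + y') = Q a b x y + Q a b x y'" "Q a b x (sK c y) = sM c (Q a b x y)"
    "Q a b (- x) y = - Q a b x y" "Q a b x (- y) = - Q a b x y"
    "Q a b 0 y = 0" "Q a b x 0 = 0"
    by (simp_all add: bilin_eqs[OF 2])
qed

locale current_superalgebra =
  k: lie_superalgebra sK K br + a: supercommutative_superalgebra sA A + m: vector_space sM
  for sK :: "'f::field \<Rightarrow> 'k::ab_group_add \<Rightarrow> 'k" and K br
    and sA :: "'f \<Rightarrow> 'a::{ring, monoid_mult} \<Rightarrow> 'a" and A
    and sM :: "'f \<Rightarrow> 'm::ab_group_add \<Rightarrow> 'm" +
  fixes sG :: "'f \<Rightarrow> 'g::ab_group_add \<Rightarrow> 'g" and tens and brG
  assumes tensor: "tensor_product sA sK sG tens"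
    and current: "current_bracket A K br sG tens brG"
begin

lemma vector_space_current: "vector_space sG"
  using tensor by (simp add: tensor_product_def)

lemma tens_bilin: "bilin sA sK sG tens"
  by (rule tensor_bilin[OF tensor a.vector_space_axioms k.vector_space_axioms])

lemma brG_bilin: "bilin sG sG sG brG"
  using current by (simp add: current_bracket_def)

lemma brG_tens:
  "x \<in> K p \<Longrightarrow> b \<in> A q \<Longrightarrow> brG (tens a x) (tens b y) = sG (psign (p * q)) (tens (a * b) (br x y))"
  using current by (simp add: current_bracket_def)

lemmas pure_tensor_induct = tensor_induct[OF tensor a.vector_space_axioms k.vector_space_axioms, case_names add tens]

abbreviation "G \<equiv> tensor_grading sG tens A K"

lemma tens_graded: "a \<in> A p \<Longrightarrow> x \<in> K r \<Longrightarrow> tens a x \<in> G (p + r)"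
proof -
  interpret g: vector_space sG by (rule vector_space_current)
  show "a \<in> A p \<Longrightarrow> x \<in> K r \<Longrightarrow> tens a x \<in> G (p + r)"
    unfolding tensor_grading_def by (rule g.span_base) blast
qed

lemma graded_induct [consumes 1, case_names zero add scale tens]:
  assumes "u \<in> G d" and "P 0" and "\<And>u v. P u \<Longrightarrow> P v \<Longrightarrow> P (u + v)"
    and "\<And>c u. P u \<Longrightarrow> P (sG c u)"
    and "\<And>p r a x. p + r = d \<Longrightarrow> a \<in> A p \<Longrightarrow> x \<in> K r \<Longrightarrow> P (tens a x)"
  shows "P u"
proof -
  interpret g: vector_space sG by (rule vector_space_current)
  show ?thesis
    using assms(1) unfolding tensor_grading_def
    by (induction rule: g.span_induct_alt) (use assms in blast)+
qed

text \<open>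
  The correspondence between forms on the tensor product and quadrilinear maps in which the
  Koszul sign for moving \<open>b\<close> past \<open>x\<close> is split off.
\<close>
definition represents :: "('g \<Rightarrow> 'g \<Rightarrow> 'm) \<Rightarrow> ('a \<Rightarrow> 'a \<Rightarrow> 'k \<Rightarrow> 'k \<Rightarrow> 'm) \<Rightarrow> bool" where
  "represents h Q \<longleftrightarrow> bilin sG sG sM h \<and> quadrilinear sA sK sM Q \<and>
     (\<forall>p q. \<forall>x\<in>K p. \<forall>b\<in>A q. \<forall>a y. h (tens a x) (tens b y) = sM (psign (p * q)) (Q a b x y))"

lemma representsD:
  assumes "represents h Q"
  shows "bilin sG sG sM h" "quadrilinear sA sK sM Q"
    "x \<in> K p \<Longrightarrow> b \<in> A q \<Longrightarrow> h (tens a x) (tens b y) = sM (psign (p * q)) (Q a b x y)"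
  using assms by (simp_all add: represents_def)

text \<open>
  The sign \<open>(-1)\<^bsup>|b||x|\<^esup>\<close> extends to inhomogeneous elements as the parity involution of \<open>A\<close>
  applied to \<open>b\<close> where \<open>x\<close> is odd. It is its own inverse, so the same formula passes
  from forms to quadrilinear maps and back.
\<close>
lemma form_of_quadrilinear:
  assumes Q: "quadrilinear sA sK sM Q"
  shows "\<exists>h. represents h Q"
proof -
  let ?R = "\<lambda>a x b y. Q a b (k.component 0 x) y + Q a (a.parity_involution b) (k.component 1 x) y"
  have "bilin sA sK sM (\<lambda>a x. ?R a x b y)" for b y
    by (rule bilinI[OF a.vector_space_axioms k.vector_space_axioms m.vector_space_axioms])
      (simp_all add: quadrilinear_eqs[OF Q] k.component_add k.component_scale m.scale_right_distrib)
  moreover have "bilin sA sK sM (\<lambda>b y. ?R a x b y)" for a x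
    by (rule bilinI[OF a.vector_space_axioms k.vector_space_axioms m.vector_space_axioms])
      (simp_all add: quadrilinear_eqs[OF Q] a.parity_involution_add a.parity_involution_scale
        m.scale_right_distrib)
  ultimately obtain h where h: "bilin sG sG sM h" "\<And>a x b y. h (tens a x) (tens b y) = ?R a x b y"
    using tensor_bilin_lift_exists[OF tensor, where R = ?R and sV = sM] by blast
  have "h (tens a x) (tens b y) = sM (psign (p * q)) (Q a b x y)" if "x \<in> K p" "b \<in> A q" for p q a b x y
    using k.component_same[OF that(1)] k.component_other[OF that(1)]
    by (cases p) (simp_all add: h(2) a.parity_involution_homogeneous[OF that(2)] quadrilinear_eqs[OF Q])
  then show ?thesis using h(1) Q unfolding represents_def by blast
qed

lemma quadrilinear_of_form:
  assumes h: "bilin sG sG sM h"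
  shows "\<exists>Q. represents h Q"
proof -
  let ?Q = "\<lambda>a b x y. h (tens a (k.component 0 x)) (tens b y)
    + h (tens a (k.component 1 x)) (tens (a.parity_involution b) y)"
  have "quadrilinear sA sK sM ?Q"
    unfolding quadrilinear_def
    by (intro conjI allI bilinI a.vector_space_axioms k.vector_space_axioms m.vector_space_axioms)
      (simp_all add: bilin_eqs[OF h] bilin_eqs[OF tens_bilin] k.component_add k.component_scale
        a.parity_involution_add a.parity_involution_scale m.scale_right_distrib)
  moreover have "h (tens a x) (tens b y) = sM (psign (p * q)) (?Q a b x y)"
    if "x \<in> K p" "b \<in> A q" for p q a b x y
    using k.component_same[OF that(1)] k.component_other[OF that(1)]
    by (cases p) (simp_all add: a.parity_involution_homogeneous[OF that(2)] bilin_eqs[OF h]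
        bilin_eqs[OF tens_bilin])
  ultimately show ?thesis using h unfolding represents_def by blast
qed

lemma current_bilin_eqI:
  assumes h: "bilin sG sG sM h" and h': "bilin sG sG sM h'"
    and eq: "\<And>p q x b a y. x \<in> K p \<Longrightarrow> b \<in> A q \<Longrightarrow> h (tens a x) (tens b y) = h' (tens a x) (tens b y)"
  shows "h = h'"
proof (intro ext)
  fix u v
  note e = bilin_eqs[OF h] bilin_eqs[OF h'] bilin_eqs[OF tens_bilin]
  show "h u v = h' u v"
  proof (rule pure_tensor_induct[of "\<lambda>u. h u v = h' u v"])
    fix a x
    show "h (tens a x) v = h' (tens a x) v"
    proof (rule pure_tensor_induct[of "\<lambda>v. h (tens a x) v = h' (tens a x) v"])
      fix b y
      show "h (tens a x) (tens b y) = h' (tens a x) (tens b y)"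
      proof (induction x rule: k.homogeneous_induct)
        case (homogeneous p x)
        note x = this
        show ?case
        proof (induction b rule: a.homogeneous_induct)
          case (homogeneous q b)
          with x show ?case by (rule eq)
        qed (simp add: e)
      qed (simp add: e)
    qed (simp add: e)
  qed (simp add: e)
qed

text \<open>
  The 2-cocycle conditions as seen by the quadrilinear map that represents a form; the signs of
  \<open>A\<close> and of \<open>K\<close> are now separate.
\<close>
definition current_cocycle :: "('a \<Rightarrow> 'a \<Rightarrow> 'k \<Rightarrow> 'k \<Rightarrow> 'm) \<Rightarrow> bool" where
  "current_cocycle Q \<longleftrightarrow>
     (\<forall>p q r s. \<forall>a\<in>A p. \<forall>b\<in>A q. \<forall>x\<in>K r. \<forall>y\<in>K s.
        Q a b x y = - sM (psign (p * q + r * s)) (Q b a y x)) \<and>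
     (\<forall>p q r s. \<forall>a\<in>A p. \<forall>b\<in>A q. \<forall>x\<in>K r. \<forall>y\<in>K s. \<forall>c z.
        Q (a * b) c (br x y) z
          = Q a (b * c) x (br y z) - sM (psign (p * q + r * s)) (Q b (a * c) y (br x z)))"

lemma current_cocycleD:
  assumes "current_cocycle Q" "a \<in> A p" "b \<in> A q" "x \<in> K r" "y \<in> K s"
  shows "Q a b x y = - sM (psign (p * q + r * s)) (Q b a y x)"
    "Q (a * b) c (br x y) z
      = Q a (b * c) x (br y z) - sM (psign (p * q + r * s)) (Q b (a * c) y (br x z))"
  using assms unfolding current_cocycle_def by blast+

lemmas mult_eqs = bilin_eqs[OF a.mult_bilin]

text \<open>
  The three terms of the cocycle identity on pure tensors. The first two carry the same sign;
  dividing the sign of the third by it turns the factor \<open>(-1)\<^bsup>(|a|+|x|)(|b|+|y|)\<^esup>\<close> of the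
  cocycle identity into \<open>(-1)\<^bsup>|a||b|+|x||y|\<^esup>\<close>.
\<close>
lemma represents_brackets:
  assumes hQ: "represents h Q" and "a \<in> A p" "b \<in> A q" "x \<in> K r" "y \<in> K s" "c \<in> A t"
  shows "h (brG (tens a x) (tens b y)) (tens c z)
      = sM (psign (r * q + (r + s) * t)) (Q (a * b) c (br x y) z)"
    "h (tens a x) (brG (tens b y) (tens c z))
      = sM (psign (r * q + (r + s) * t)) (Q a (b * c) x (br y z))"
    "h (tens b y) (brG (tens a x) (tens c z))
      = sM (psign (r * t + s * p + s * t)) (Q b (a * c) y (br x z))"
  using assms(2-) k.bracket_graded[of x r y s] a.mult_graded[of a p c t] a.mult_graded[of b q c t]
  by (simp_all add: brG_tens bilin_eqs[OF representsD(1)[OF hQ]] representsD(3)[OF hQ]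
      psign_add[symmetric] algebra_simps)

lemma represents_cocycle_iff:
  assumes hQ: "represents h Q"
  shows "h \<in> cocycles sG G brG sM \<longleftrightarrow> current_cocycle Q"
proof
  note Q = quadrilinear_eqs[OF representsD(2)[OF hQ]] and h = bilin_eqs[OF representsD(1)[OF hQ]]
  note eqs = h bilin_eqs[OF tens_bilin] bilin_eqs[OF brG_bilin]
  {
    assume "h \<in> cocycles sG G brG sM"
    then have skew: "h u v = - sM (psign (d * e)) (h v u)"
      and cocycle: "h (brG u v) w = h u (brG v w) - sM (psign (d * e)) (h v (brG u w))"
      if "u \<in> G d" "v \<in> G e" for u v w d e
      using that unfolding cocycles_def by blast+
    show "current_cocycle Q"
      unfolding current_cocycle_def
    proof (intro conjI allI ballI)
      fix p q r s a b x y
      assume hom: "a \<in> A p" "b \<in> A q" "x \<in> K r" "y \<in> K s"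
      have "sM (psign (r * q)) (Q a b x y)
          = - sM (psign ((p + r) * (q + s))) (sM (psign (s * p)) (Q b a y x))"
        using skew[OF tens_graded[OF hom(1,3)] tens_graded[OF hom(2,4)]] hom
        by (simp add: representsD(3)[OF hQ])
      then show "Q a b x y = - sM (psign (p * q + r * s)) (Q b a y x)"
        by (cases p; cases q; cases r; cases s)
          (simp_all add: eq_neg_iff_add_eq_0 neg_eq_iff_add_eq_0 add.commute)
      fix c z
      show "Q (a * b) c (br x y) z
          = Q a (b * c) x (br y z) - sM (psign (p * q + r * s)) (Q b (a * c) y (br x z))"
      proof (induction c rule: a.homogeneous_induct)
        case (homogeneous t c)
        note hb = represents_brackets[OF hQ hom homogeneous, of z]
        have "sM (psign (r * q + (r + s) * t)) (Q (a * b) c (br x y) z)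
          = sM (psign (r * q + (r + s) * t)) (Q a (b * c) x (br y z))
          - sM (psign ((p + r) * (q + s))) (sM (psign (r * t + s * p + s * t)) (Q b (a * c) y (br x z)))"
          using cocycle[OF tens_graded[OF hom(1,3)] tens_graded[OF hom(2,4)], of "tens c z"]
          unfolding hb .
        then show ?case
          by (cases p; cases q; cases r; cases s; cases t) (simp_all add: algebra_simps)
      qed (simp add: Q mult_eqs m.scale_right_distrib)
    qed
  }
  assume cc: "current_cocycle Q"
  have skew: "h u v = - sM (psign (d * e)) (h v u)" if u: "u \<in> G d" and v: "v \<in> G e" for d e u v
    using u
  proof (induction rule: graded_induct)
    case (tens p r a x)
    note ax = this
    show ?case using v
    proof (induction rule: graded_induct)
      case (tens q s b y)
      have "h (tens a x) (tens b y) = sM (psign (r * q)) (Q a b x y)"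
        "h (tens b y) (tens a x) = sM (psign (s * p)) (Q b a y x)"
        using ax tens by (simp_all add: representsD(3)[OF hQ])
      then show ?case
        unfolding ax(1)[symmetric] tens(1)[symmetric] current_cocycleD(1)[OF cc ax(2) tens(2) ax(3) tens(3)]
        by (cases p; cases q; cases r; cases s) simp_all
    qed (simp_all add: h m.scale_right_distrib mult.commute)
  qed (simp_all add: h m.scale_right_distrib mult.commute)
  have cocycle: "h (brG u v) w = h u (brG v w) - sM (psign (d * e)) (h v (brG u w))"
    if u: "u \<in> G d" and v: "v \<in> G e" for d e u v w
    using u
  proof (induction rule: graded_induct)
    case (tens p r a x)
    note ax = this
    show ?case using v
    proof (induction rule: graded_induct)
      case (tens q s b y)
      note hom = ax(2) tens(2) ax(3) tens(3)
      show ?case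
      proof (rule pure_tensor_induct[of "\<lambda>w. h (brG (tens a x) (tens b y)) w = h (tens a x) (brG (tens b y) w)
            - sM (psign (d * e)) (h (tens b y) (brG (tens a x) w))"])
        fix c z
        show "h (brG (tens a x) (tens b y)) (tens c z) = h (tens a x) (brG (tens b y) (tens c z))
            - sM (psign (d * e)) (h (tens b y) (brG (tens a x) (tens c z)))"
        proof (induction c rule: a.homogeneous_induct)
          case (homogeneous t c)
          show ?case
            unfolding represents_brackets[OF hQ hom homogeneous] ax(1)[symmetric] tens(1)[symmetric]
              current_cocycleD(2)[OF cc hom]
            by (cases p; cases q; cases r; cases s; cases t) simp_all
        qed (simp add: eqs m.scale_right_distrib)
      qed (simp add: eqs m.scale_right_distrib)
    qed (simp_all add: eqs m.scale_right_distrib m.scale_right_diff_distrib mult.commute)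
  qed (simp_all add: eqs m.scale_right_distrib m.scale_right_diff_distrib mult.commute)
  show "h \<in> cocycles sG G brG sM"
    unfolding cocycles_def using representsD(1)[OF hQ] skew cocycle by blast
qed

end

context current_superalgebra
begin

lemma current_cocycle_diff:
  assumes "current_cocycle Q" "current_cocycle Q'"
  shows "current_cocycle (\<lambda>a b x y. Q a b x y - Q' a b x y)"
  unfolding current_cocycle_def
proof (intro conjI allI ballI)
  fix p q r s a b x y
  assume hom: "a \<in> A p" "b \<in> A q" "x \<in> K r" "y \<in> K s"
  show "Q a b x y - Q' a b x y = - sM (psign (p * q + r * s)) (Q b a y x - Q' b a y x)"
    unfolding current_cocycleD(1)[OF assms(1) hom] current_cocycleD(1)[OF assms(2) hom]
    by (simp add: m.scale_right_diff_distrib)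
  show "Q (a * b) c (br x y) z - Q' (a * b) c (br x y) z
      = (Q a (b * c) x (br y z) - Q' a (b * c) x (br y z))
        - sM (psign (p * q + r * s)) (Q b (a * c) y (br x z) - Q' b (a * c) y (br x z))" for c z
    unfolding current_cocycleD(2)[OF assms(1) hom] current_cocycleD(2)[OF assms(2) hom]
    by (simp add: m.scale_right_diff_distrib)
qed

lemma quadrilinear_diff:
  assumes "quadrilinear sA sK sM Q" "quadrilinear sA sK sM Q'"
  shows "quadrilinear sA sK sM (\<lambda>a b x y. Q a b x y - Q' a b x y)"
  using assms by (simp add: quadrilinear_def bilin_diff)

lemma quadrilinear_product:
  assumes "\<And>x y. Vector_Spaces.linear sA sM (\<lambda>c. \<Phi> c x y)" and "\<And>c. bilin sK sK sM (\<Phi> c)"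
  shows "quadrilinear sA sK sM (\<lambda>a b x y. \<Phi> (a * b) x y)"
  unfolding quadrilinear_def
  using bilin_linear_comp[OF a.mult_bilin assms(1)] assms(2) by blast

text \<open>
  Composing with the product of \<open>A\<close> makes the three \<open>A\<close>-arguments of the cocycle identity equal
  up to the sign \<open>(-1)\<^bsup>|a||b|\<^esup>\<close>, so the conditions reduce to those on \<open>K\<close>. This applies both
  to \<open>\<Phi>\<^sub>c = Q(1, c, -, -)\<close> and to coboundaries.
\<close>
lemma current_cocycle_product:
  assumes lin: "\<And>x y. Vector_Spaces.linear sA sM (\<lambda>c. \<Phi> c x y)"
    and cocycle: "\<And>c. \<Phi> c \<in> cocycles sK K br sM"
  shows "current_cocycle (\<lambda>a b x y. \<Phi> (a * b) x y)"
  unfolding current_cocycle_def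
proof (intro conjI allI ballI)
  fix p q r s a b x y
  assume hom: "a \<in> A p" "b \<in> A q" "x \<in> K r" "y \<in> K s"
  have skew: "\<Phi> c x y = - sM (psign (r * s)) (\<Phi> c y x)"
    and jacobi: "\<Phi> c (br x y) z = \<Phi> c x (br y z) - sM (psign (r * s)) (\<Phi> c y (br x z))" for c z
    using cocycle[of c] hom(3,4) unfolding cocycles_def by blast+
  have flip: "\<Phi> (b * (a * c)) u v = sM (psign (p * q)) (\<Phi> (a * (b * c)) u v)" for c u v
    by (simp add: mult.assoc[symmetric] a.supercommutative[OF hom(1,2)] mult_eqs linear_eqs[OF lin])
  show "\<Phi> (a * b) x y = - sM (psign (p * q + r * s)) (\<Phi> (b * a) y x)"
    by (subst skew) (use flip[of 1 y x] in \<open>simp add: psign_add mult.commute\<close>)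
  show "\<Phi> (a * b * c) (br x y) z = \<Phi> (a * (b * c)) x (br y z)
      - sM (psign (p * q + r * s)) (\<Phi> (b * (a * c)) y (br x z))" for c z
    unfolding jacobi by (simp add: flip psign_add mult.assoc mult.commute)
qed

lemma current_cocycle_at_one:
  assumes Q: "current_cocycle Q" and xy: "x \<in> K p" "y \<in> K q"
  shows "Q 1 c (br x y) z = Q 1 c x (br y z) - sM (psign (p * q)) (Q 1 c y (br x z))"
  using current_cocycleD(2)[OF Q a.one_even a.one_even xy, of c z] by simp

text \<open>
  With \<open>a = 1\<close> the first term on the right of the cocycle identity vanishes. What is left is
  invariance, up to exchanging the arguments of the bracket on the left.
\<close>
lemma current_cocycle_invariant:
  assumes lin: "quadrilinear sA sK sM Q" and Q: "current_cocycle Q"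
    and zero: "\<And>c x y. Q 1 c x y = 0"
  shows "Q b c (br x y) z = Q b c x (br y z)"
proof (induction b rule: a.homogeneous_induct)
  note e = quadrilinear_eqs[OF lin] bilin_eqs[OF k.bracket_bilin]
  case (homogeneous q b)
  note b = this
  show ?case
  proof (induction x rule: k.homogeneous_induct)
    case (homogeneous r x)
    note x = this
    show ?case
    proof (induction y rule: k.homogeneous_induct)
      case (homogeneous s y)
      have "Q b c (br y x) z = - sM (psign (s * r)) (Q b c x (br y z))"
        using current_cocycleD(2)[OF Q a.one_even b homogeneous x, of c z] by (simp add: zero)
      then show ?case
        by (subst k.bracket_skew[OF x homogeneous]) (simp add: e mult.commute)
    qed (simp add: e)
  qed (simp add: e)
qed (simp add: quadrilinear_eqs[OF lin])

text \<open>
  The defining rule of \<^const>\<open>current_form\<close> has exactly one solution; existence needs \<open>T\<close> and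
  \<open>\<Phi>\<close> to be linear and bilinear.
\<close>
lemma current_form_eqs:
  assumes \<kappa>: "bilin sK sK (*) \<kappa>" and T: "Vector_Spaces.linear sK sK T" and \<Phi>: "bilin sA sA sM \<Phi>"
  shows "bilin sG sG sM (current_form A K \<kappa> sG tens sM \<Phi> T)"
    and "x \<in> K p \<Longrightarrow> b \<in> A q \<Longrightarrow> current_form A K \<kappa> sG tens sM \<Phi> T (tens a x) (tens b y)
      = sM (psign (q * p) * \<kappa> (T x) y) (\<Phi> a b)"
proof -
  let ?rule = "\<lambda>h. bilin sG sG sM h \<and> (\<forall>p q. \<forall>x\<in>K p. \<forall>b\<in>A q. \<forall>a y.
        h (tens a x) (tens b y) = sM (psign (q * p) * \<kappa> (T x) y) (\<Phi> a b))"
  have "quadrilinear sA sK sM (\<lambda>a b x y. sM (\<kappa> (T x) y) (\<Phi> a b))"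
    unfolding quadrilinear_def
    by (intro conjI allI bilinI a.vector_space_axioms k.vector_space_axioms m.vector_space_axioms)
      (simp_all add: bilin_eqs[OF \<kappa>] linear_eqs[OF T] bilin_eqs[OF \<Phi>] m.scale_right_distrib
        m.scale_left_distrib mult.commute)
  then obtain h where h: "represents h (\<lambda>a b x y. sM (\<kappa> (T x) y) (\<Phi> a b))"
    using form_of_quadrilinear by blast
  have "?rule h"
    using representsD(1,3)[OF h] by (simp add: mult.commute)
  moreover have "h' = h" if "?rule h'" for h'
    by (rule current_bilin_eqI) (use that \<open>?rule h\<close> in auto)
  ultimately have r: "?rule (current_form A K \<kappa> sG tens sM \<Phi> T)"
    unfolding current_form_def by (rule theI)
  show "bilin sG sG sM (current_form A K \<kappa> sG tens sM \<Phi> T)" using r by blast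
  show "x \<in> K p \<Longrightarrow> b \<in> A q \<Longrightarrow> current_form A K \<kappa> sG tens sM \<Phi> T (tens a x) (tens b y)
      = sM (psign (q * p) * \<kappa> (T x) y) (\<Phi> a b)" using r by blast
qed

end

section \<open>Decomposition of 2-cocycles\<close>

locale current_quadratic = current_superalgebra + k: perfect_quadratic sK K br \<kappa> for \<kappa>
begin

text \<open>
  For each \<open>c\<close> the cocycle \<open>Q(1, c, -, -)\<close> is expanded in the basis of \<open>H\<^sup>2\<close>. The coefficients are
  linear in \<open>c\<close> because relations modulo coboundaries are trivial, and then so is the error term,
  which is determined by its values on brackets.
\<close>
lemma cocycle_at_one_decomposition:
  assumes basis: "H2_basis sK K br n \<alpha>" and Q: "quadrilinear sA sK sM Q"
    and cocycle: "\<And>c. Q 1 c \<in> cocycles sK K br sM"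
  shows "\<exists>f g. (\<forall>i\<in>{1..n}. Vector_Spaces.linear sA sM (f i)) \<and> bilin sA sK sM g \<and>
    (\<forall>c x y. Q 1 c x y = (\<Sum>i = 1..n. sM (\<alpha> i x y) (f i c)) + g c (br x y))"
proof -
  note e = quadrilinear_eqs[OF Q]
  obtain v g where g: "\<And>c. Vector_Spaces.linear sK sM (g c)"
    and vg: "\<And>c x y. Q 1 c x y = (\<Sum>i = 1..n. sM (\<alpha> i x y) (v c i)) + g c (br x y)"
    using k.vector_valued_cocycle_decomposition[OF basis cocycle] by metis
  note ge = linear_eqs[OF g]
  have unique: "w i = 0" if "Vector_Spaces.linear sK sM h" "i \<in> {1..n}"
    "\<And>x y. (\<Sum>i = 1..n. sM (\<alpha> i x y) (w i)) + h (br x y) = 0" for w h i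
    by (rule k.H2_basis_independent[OF basis m.vector_space_axioms that(1,3,2)])
  have v_add: "v (c + c') i = v c i + v c' i" if i: "i \<in> {1..n}" for c c' i
  proof -
    have "v (c + c') i - v c i - v c' i = 0"
    proof (rule unique[OF _ i, where h = "\<lambda>u. g (c + c') u - g c u - g c' u"])
      show "Vector_Spaces.linear sK sM (\<lambda>u. g (c + c') u - g c u - g c' u)"
        by (rule linearI[OF k.vector_space_axioms m.vector_space_axioms])
          (simp_all add: ge m.scale_right_diff_distrib)
      show "(\<Sum>i = 1..n. sM (\<alpha> i x y) (v (c + c') i - v c i - v c' i))
          + (g (c + c') (br x y) - g c (br x y) - g c' (br x y)) = 0" for x y
        using vg[of "c + c'" x y] vg[of c x y] vg[of c' x y]
        by (simp add: e m.scale_right_diff_distrib sum_subtractf sum.distrib algebra_simps)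
    qed
    then show ?thesis by (simp add: algebra_simps)
  qed
  have v_scale: "v (sA d c) i = sM d (v c i)" if i: "i \<in> {1..n}" for c d i
  proof -
    have "v (sA d c) i - sM d (v c i) = 0"
    proof (rule unique[OF _ i, where h = "\<lambda>u. g (sA d c) u - sM d (g c u)"])
      show "Vector_Spaces.linear sK sM (\<lambda>u. g (sA d c) u - sM d (g c u))"
        by (rule linearI[OF k.vector_space_axioms m.vector_space_axioms])
          (simp_all add: ge m.scale_right_diff_distrib m.scale_right_distrib mult.commute)
      show "(\<Sum>i = 1..n. sM (\<alpha> i x y) (v (sA d c) i - sM d (v c i)))
          + (g (sA d c) (br x y) - sM d (g c (br x y))) = 0" for x y
      proof -
        have "(\<Sum>i = 1..n. sM (\<alpha> i x y) (v (sA d c) i)) + g (sA d c) (br x y)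
            = sM d ((\<Sum>i = 1..n. sM (\<alpha> i x y) (v c i)) + g c (br x y))"
          unfolding vg[symmetric] by (simp add: e)
        then show ?thesis
          by (simp add: m.scale_right_distrib m.scale_sum_right m.scale_right_diff_distrib
              sum_subtractf mult.commute algebra_simps)
      qed
    qed
    then show ?thesis by simp
  qed
  have "bilin sA sK sM g"
  proof (rule bilinI[OF a.vector_space_axioms k.vector_space_axioms m.vector_space_axioms])
    fix c c' d u
    have "Vector_Spaces.linear sK sM (\<lambda>u. g c u + g c' u)"
      "Vector_Spaces.linear sK sM (\<lambda>u. sM d (g c u))"
      by (rule linearI[OF k.vector_space_axioms m.vector_space_axioms];
          simp add: ge m.scale_right_distrib mult.commute add_ac)+
    note eqI = this[THEN k.linear_eq_on_brackets[OF g]]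
    show "g (c + c') u = g c u + g c' u"
    proof (rule eqI(1))
      fix x y
      show "g (c + c') (br x y) = g c (br x y) + g c' (br x y)"
        using vg[of "c + c'" x y] vg[of c x y] vg[of c' x y]
        by (simp add: e v_add m.scale_right_distrib sum.distrib algebra_simps)
    qed
    show "g (sA d c) u = sM d (g c u)"
    proof (rule eqI(2))
      fix x y
      have "(\<Sum>i = 1..n. sM (\<alpha> i x y) (v (sA d c) i)) + g (sA d c) (br x y)
          = sM d ((\<Sum>i = 1..n. sM (\<alpha> i x y) (v c i)) + g c (br x y))"
        unfolding vg[symmetric] by (simp add: e)
      then show "g (sA d c) (br x y) = sM d (g c (br x y))"
        by (simp add: v_scale m.scale_right_distrib m.scale_sum_right mult.commute)
    qed
  qed (simp_all add: ge)
  moreover have "Vector_Spaces.linear sA sM (\<lambda>c. v c i)" if "i \<in> {1..n}" for i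
    by (rule linearI[OF a.vector_space_axioms m.vector_space_axioms])
      (simp_all add: v_add[OF that] v_scale[OF that])
  ultimately show ?thesis using vg by (intro exI[of _ "\<lambda>i c. v c i"] exI[of _ g]) blast
qed

text \<open>
  Invariance and symmetry allow the \<open>K\<close>-arguments in the cocycle conditions to be brought to the
  same order on both sides, at the cost of \<open>(-1)\<^bsup>|x||y|\<^esup>\<close>. Comparing coefficients of the linearly
  independent forms \<open>\<alpha>\<^sub>j\<close> leaves the Hochschild conditions.
\<close>
lemma invariant_current_cocycle_decomposition:
  assumes basis: "forms_basis n \<alpha> (invariant_forms sK K br)"
    and Q: "quadrilinear sA sK sM Q" and cocycle: "current_cocycle Q"
    and inv: "\<And>b c x y z. Q b c (br x y) z = Q b c x (br y z)"
  shows "\<exists>F. (\<forall>j\<in>{1..n}. hochschild_map sA A sM (F j)) \<and>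
    (\<forall>a b x y. Q a b x y = (\<Sum>j = 1..n. sM (\<alpha> j x y) (F j a b)))"
proof -
  note e = quadrilinear_eqs[OF Q]
  have bil: "bilin sK sK sM (Q a b)" for a b using Q by (simp add: quadrilinear_def)
  obtain v where v: "\<And>a b x y. Q a b x y = (\<Sum>j = 1..n. sM (\<alpha> j x y) (v a b j))"
    using k.vector_valued_invariant_decomposition[OF basis bil inv] by metis
  have unique: "w j = w' j" if j: "j \<in> {1..n}"
    and "\<And>x y. (\<Sum>i = 1..n. sM (\<alpha> i x y) (w i)) = (\<Sum>i = 1..n. sM (\<alpha> i x y) (w' i))" for w w' j
    using forms_basis_independent[OF basis m.vector_space_axioms _ j, of "\<lambda>i. w i - w' i"] that
    by (simp add: m.scale_right_diff_distrib sum_subtractf)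
  have scaled: "(\<Sum>j = 1..n. sM (\<alpha> j x y) (sM d (v a b j))) = sM d (Q a b x y)" for a b x y d
    by (simp add: v m.scale_sum_right mult.commute)
  have sym: "Q a b x y = sM (psign (p * q)) (Q a b y x)" if "x \<in> K p" "y \<in> K q" for a b p q x y
    by (rule k.invariant_imp_symmetric[OF bil inv that])
  have skew: "Q a b x y = - sM (psign (p * q)) (Q b a x y)" if ab: "a \<in> A p" "b \<in> A q" for p q a b x y
  proof (induction x rule: k.homogeneous_induct)
    case (homogeneous r x)
    note x = this
    show ?case
    proof (induction y rule: k.homogeneous_induct)
      case (homogeneous s y)
      have "Q a b x y = - sM (psign (p * q + r * s)) (Q b a y x)"
        by (rule current_cocycleD(1)[OF cocycle ab x homogeneous])
      also have "Q b a y x = sM (psign (s * r)) (Q b a x y)" by (rule sym[OF homogeneous x])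
      finally show ?case by (simp add: psign_add mult.commute[of s r] mult.assoc)
    qed (simp add: e m.scale_right_distrib)
  qed (simp add: e m.scale_right_distrib)
  have hoch: "Q (a * b) c u z = Q a (b * c) u z + sM (psign (p * q)) (Q b (a * c) u z)"
    if ab: "a \<in> A p" "b \<in> A q" for p q a b c u z
  proof (induction u rule: k.bracket_induct)
    case (bracket r s x y)
    have "Q b (a * c) y (br x z) = Q b (a * c) (br y x) z" by (simp add: inv)
    also have "\<dots> = - sM (psign (s * r)) (Q b (a * c) (br x y) z)"
      by (subst k.bracket_skew[OF bracket(2,1)]) (simp add: e)
    finally show ?case
      using current_cocycleD(2)[OF cocycle ab bracket, of c z]
      by (simp add: inv psign_add mult.commute[of s r] mult.assoc)
  qed (simp_all add: e m.scale_right_distrib)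
  have "hochschild_map sA A sM (\<lambda>a b. v a b j)" if j: "j \<in> {1..n}" for j
    unfolding hochschild_map_def
  proof (intro conjI allI ballI)
    show "bilin sA sA sM (\<lambda>a b. v a b j)"
    proof (rule bilinI[OF a.vector_space_axioms a.vector_space_axioms m.vector_space_axioms])
      fix a a' b d
      show "v (a + a') b j = v a b j + v a' b j" "v b (a + a') j = v b a j + v b a' j"
        by (rule unique[OF j], unfold m.scale_right_distrib sum.distrib v[symmetric], rule e)+
      show "v (sA d a) b j = sM d (v a b j)" "v b (sA d a) j = sM d (v b a j)"
        by (rule unique[OF j], unfold scaled v[symmetric], rule e)+
    qed
    fix p q a b assume ab: "a \<in> A p" "b \<in> A q"
    show "v a b j = - sM (psign (p * q)) (v b a j)"
      unfolding m.scale_minus_left[symmetric]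
      by (rule unique[OF j], unfold scaled v[symmetric]) (simp add: skew[OF ab])
    show "v (a * b) c j = v a (b * c) j + sM (psign (p * q)) (v b (a * c) j)" for c
      by (rule unique[OF j], unfold m.scale_right_distrib sum.distrib scaled v[symmetric])
        (rule hoch[OF ab])
  qed
  then show ?thesis using v by (intro exI[of _ "\<lambda>j a b. v a b j"]) blast
qed

text \<open>
  The part \<open>Q(1, ab, x, y)\<close> is subtracted as a whole, because derivation invariance makes the
  whole of \<open>Q(1, c, -, -)\<close> a cocycle; its expansion enters only in the final formula.
\<close>
lemma current_cocycle_decomposition:
  assumes inv: "derivation_invariant sK K br \<kappa>"
    and H2: "H2_basis sK K br t \<delta>" and Sym: "forms_basis m \<sigma> (invariant_forms sK K br)"
    and Q: "quadrilinear sA sK sM Q" and cocycle: "current_cocycle Q"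
  shows "\<exists>f F g. (\<forall>i\<in>{1..t}. Vector_Spaces.linear sA sM (f i)) \<and>
    (\<forall>j\<in>{1..m}. hochschild_map sA A sM (F j)) \<and> bilin sA sK sM g \<and>
    (\<forall>a b x y. Q a b x y = (\<Sum>i = 1..t. sM (\<delta> i x y) (f i (a * b)))
      + (\<Sum>j = 1..m. sM (\<sigma> j x y) (F j a b)) + g (a * b) (br x y))"
proof -
  have bil: "bilin sK sK sM (Q 1 c)" and lin: "Vector_Spaces.linear sA sM (\<lambda>c. Q 1 c x y)" for c x y
    using Q by (auto simp: quadrilinear_def bilin_def)
  have one: "Q 1 c \<in> cocycles sK K br sM" for c
    by (rule k.vector_valued_derivation_form_cocycle[OF inv bil current_cocycle_at_one[OF cocycle]])
  obtain f g where f: "\<forall>i\<in>{1..t}. Vector_Spaces.linear sA sM (f i)" and g: "bilin sA sK sM g"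
    and fg: "\<And>c x y. Q 1 c x y = (\<Sum>i = 1..t. sM (\<delta> i x y) (f i c)) + g c (br x y)"
    using cocycle_at_one_decomposition[OF H2 Q one] by blast
  let ?R = "\<lambda>a b x y. Q a b x y - Q 1 (a * b) x y"
  have R: "quadrilinear sA sK sM ?R"
    by (rule quadrilinear_diff[OF Q quadrilinear_product[OF lin bil]])
  have Rc: "current_cocycle ?R"
    by (rule current_cocycle_diff[OF cocycle current_cocycle_product[OF lin one]])
  have "?R b c (br x y) z = ?R b c x (br y z)" for b c x y z
    by (rule current_cocycle_invariant[OF R Rc]) simp
  from invariant_current_cocycle_decomposition[OF Sym R Rc this]
  obtain F where F: "\<forall>j\<in>{1..m}. hochschild_map sA A sM (F j)"
    "\<And>a b x y. ?R a b x y = (\<Sum>j = 1..m. sM (\<sigma> j x y) (F j a b))" by blast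
  have "Q a b x y = (\<Sum>i = 1..t. sM (\<delta> i x y) (f i (a * b)))
      + (\<Sum>j = 1..m. sM (\<sigma> j x y) (F j a b)) + g (a * b) (br x y)" for a b x y
    using F(2)[of a b x y] fg[of "a * b" x y] by (simp add: algebra_simps)
  then show ?thesis using f g F(1) by blast
qed

end

theorem theorem3p16:
  fixes sK :: "'f::field_char_0 \<Rightarrow> 'k::ab_group_add \<Rightarrow> 'k"
    and K :: "bit \<Rightarrow> 'k set"
    and br :: "'k \<Rightarrow> 'k \<Rightarrow> 'k"
    and \<kappa> :: "'k \<Rightarrow> 'k \<Rightarrow> 'f"
    and sA :: "'f \<Rightarrow> 'a::{ring, monoid_mult} \<Rightarrow> 'a"
    and A :: "bit \<Rightarrow> 'a set"
    and sG :: "'f \<Rightarrow> 'g::ab_group_add \<Rightarrow> 'g"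
    and tens :: "'a \<Rightarrow> 'k \<Rightarrow> 'g"
    and brG :: "'g \<Rightarrow> 'g \<Rightarrow> 'g"
    and sM :: "'f \<Rightarrow> 'm::ab_group_add \<Rightarrow> 'm"
    and M :: "bit \<Rightarrow> 'm set"
    and t m :: nat
    and D S :: "nat \<Rightarrow> 'k \<Rightarrow> 'k"
    and \<omega> :: "'g \<Rightarrow> 'g \<Rightarrow> 'm"
  assumes "lie_superalgebra sK K br"
    and "finite_dimensional sK"
    and "perfect sK br"
    and "bilin sK sK (*) \<kappa>"
    and "nondegenerate \<kappa>"
    and "homogeneous_form K \<kappa>"
    and "invariant_form br \<kappa>"
    and "supersymmetric K \<kappa>"
    and "supercommutative_superalgebra sA A"
    and "tensor_product sA sK sG tens"
    and "current_bracket A K br sG tens brG"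
    and "derivation_invariant sK K br \<kappa>"
    and "\<forall>i\<in>{1..t}. D i \<in> der sK K br"
    and "H2_basis sK K br t (\<lambda>i. twist_form \<kappa> (D i))"
    and "\<forall>j\<in>{1..m}. S j \<in> cent_plus sK K br \<kappa>"
    and "forms_basis m (\<lambda>j. twist_form \<kappa> (S j)) (invariant_forms sK K br)"
    and "superspace sM M"
    and "\<omega> \<in> cocycles sG (tensor_grading sG tens A K) brG sM"
  shows "\<exists>f F \<omega>'.
    (\<forall>i\<in>{1..t}. Vector_Spaces.linear sA sM (f i)) \<and>
    (\<forall>j\<in>{1..m}. hochschild_map sA A sM (F j)) \<and>
    (\<omega>, \<omega>') \<in> cohomologous sG (tensor_grading sG tens A K) brG sM \<and>
    \<omega>' = (\<lambda>u v. (\<Sum>i = 1..t. eta A K \<kappa> sG tens sM (f i) (D i) u v)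
               + (\<Sum>j = 1..m. xi A K \<kappa> sG tens sM (F j) (S j) u v)) \<and>
    (\<forall>p q r s. \<forall>a\<in>A r. \<forall>b\<in>A q. \<forall>x\<in>K p. \<forall>y\<in>K s.
       \<omega>' (tens a x) (tens b y) =
         sM (psign (q * p)) (\<Sum>i = 1..t. sM (\<kappa> (D i x) y) (f i (a * b)))
       + sM (psign (q * p)) (\<Sum>j = 1..m. sM (\<kappa> (S j x) y) (F j a b)))"
proof -
  interpret N: superspace sM M by fact
  interpret current_quadratic sK K br sA A sM sG tens brG \<kappa>
    using assms(2-5,7,10,11)
    by (intro current_quadratic.intro current_superalgebra.intro current_superalgebra_axioms.intro
        perfect_quadratic.intro perfect_quadratic_axioms.intro assms(1,9) N.vector_space_axioms)
  obtain Q where \<omega>Q: "represents \<omega> Q"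
    using assms(18) quadrilinear_of_form[of \<omega>] by (auto simp: cocycles_def)
  note Q = representsD(2)[OF \<omega>Q]
  have Qc: "current_cocycle Q" using assms(18) by (simp add: represents_cocycle_iff[OF \<omega>Q])
  obtain f F g where f: "\<forall>i\<in>{1..t}. Vector_Spaces.linear sA sM (f i)"
    and F: "\<forall>j\<in>{1..m}. hochschild_map sA A sM (F j)" and g: "bilin sA sK sM g"
    and Q_eq: "\<And>a b x y. Q a b x y = (\<Sum>i = 1..t. sM (twist_form \<kappa> (D i) x y) (f i (a * b)))
      + (\<Sum>j = 1..m. sM (twist_form \<kappa> (S j) x y) (F j a b)) + g (a * b) (br x y)"
    using current_cocycle_decomposition[OF assms(12,14,16) Q Qc] by blast
  let ?eta = "\<lambda>i. eta A K \<kappa> sG tens sM (f i) (D i)"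
  let ?xi = "\<lambda>j. xi A K \<kappa> sG tens sM (F j) (S j)"
  have D: "Vector_Spaces.linear sK sK (D i)" if "i \<in> {1..t}" for i
    using assms(13) that by (simp add: der_def)
  have S: "Vector_Spaces.linear sK sK (S j)" if "j \<in> {1..m}" for j
    using assms(15) that by (simp add: cent_plus_def centroid_def)
  have f_mult: "bilin sA sA sM (\<lambda>a b. f i (a * b))" if "i \<in> {1..t}" for i
    using f that by (intro bilin_linear_comp[OF a.mult_bilin]) blast
  have F_bilin: "bilin sA sA sM (F j)" if "j \<in> {1..m}" for j
    using F that by (simp add: hochschild_map_def)
  note eta = current_form_eqs[OF assms(4) D f_mult, folded eta_def]
    and xi = current_form_eqs[OF assms(4) S F_bilin, folded xi_def]
  define \<omega>' where "\<omega>' = (\<lambda>u v. (\<Sum>i = 1..t. ?eta i u v) + (\<Sum>j = 1..m. ?xi j u v))"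
  have \<omega>'_tens: "\<omega>' (tens a x) (tens b y)
      = sM (psign (q * p)) (\<Sum>i = 1..t. sM (\<kappa> (D i x) y) (f i (a * b)))
      + sM (psign (q * p)) (\<Sum>j = 1..m. sM (\<kappa> (S j x) y) (F j a b))"
    if "b \<in> A q" "x \<in> K p" for p q a b x y
    unfolding \<omega>'_def using that by (simp add: eta xi k.scale_sum_right N.scale_sum_right)
  have \<omega>'_bilin: "bilin sG sG sM \<omega>'"
  proof -
    have "bilin sG sG sM (\<lambda>u v. \<Sum>i = 1..t. ?eta i u v)" "bilin sG sG sM (\<lambda>u v. \<Sum>j = 1..m. ?xi j u v)"
      by (rule bilin_sum[OF vector_space_current vector_space_current N.vector_space_axioms]; rule eta xi; assumption)+
    note e = bilin_eqs[OF this(1)] bilin_eqs[OF this(2)]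
    show ?thesis
      unfolding \<omega>'_def
      by (rule bilinI[OF vector_space_current vector_space_current N.vector_space_axioms])
        (simp_all only: e N.scale_right_distrib add_ac)
  qed
  obtain l where l: "Vector_Spaces.linear sG sM l" "\<And>a x. l (tens a x) = g a x"
    using tensor_lift_exists[OF tensor g] by blast
  \<comment> \<open>\<open>\<omega>'\<close> is a cocycle because \<open>\<omega>\<close> and the coboundary of \<open>l\<close> are.\<close>
  let ?\<Phi> = "\<lambda>c x y. g c (br x y)"
  have \<Phi>: "Vector_Spaces.linear sA sM (\<lambda>c. ?\<Phi> c x y)" "?\<Phi> c \<in> cocycles sK K br sM" for c x y
    using bilin_linear[OF g] k.coboundary_cocycle by blast+
  have \<Phi>_bilin: "bilin sK sK sM (?\<Phi> c)" for c
    using \<Phi>(2) by (simp add: cocycles_def)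
  have "represents \<omega>' (\<lambda>a b x y. Q a b x y - ?\<Phi> (a * b) x y)"
    unfolding represents_def
    using \<omega>'_bilin quadrilinear_diff[OF Q quadrilinear_product[OF \<Phi>(1) \<Phi>_bilin]]
    by (simp add: \<omega>'_tens Q_eq twist_form_def N.scale_right_distrib mult.commute)
  then have \<omega>'_cocycle: "\<omega>' \<in> cocycles sG G brG sM"
    by (simp add: represents_cocycle_iff current_cocycle_diff[OF Qc current_cocycle_product[OF \<Phi>]])
  have "(\<lambda>u v. \<omega> u v - \<omega>' u v) = (\<lambda>u v. l (brG u v))"
  proof (rule current_bilin_eqI)
    show "bilin sG sG sM (\<lambda>u v. \<omega> u v - \<omega>' u v)"
      by (rule bilin_diff[OF representsD(1)[OF \<omega>Q] \<omega>'_bilin])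
    show "bilin sG sG sM (\<lambda>u v. l (brG u v))"
      by (rule bilin_linear_comp[OF brG_bilin l(1)])
    fix p q x b a y assume xb: "x \<in> K p" "b \<in> A q"
    show "\<omega> (tens a x) (tens b y) - \<omega>' (tens a x) (tens b y) = l (brG (tens a x) (tens b y))"
      using xb by (simp add: \<omega>'_tens representsD(3)[OF \<omega>Q] Q_eq brG_tens linear_eqs[OF l(1)] l(2)
          twist_form_def N.scale_right_distrib mult.commute)
  qed
  then have "(\<omega>, \<omega>') \<in> cohomologous sG G brG sM"
    using assms(18) \<omega>'_cocycle l(1) unfolding cohomologous_def coboundaries_def by auto
  then show ?thesis
    using f F \<omega>'_tens by (intro exI[of _ f] exI[of _ F] exI[of _ \<omega>'] conjI \<omega>'_def) blast+
qed

end
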